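(* Let $G_5$ be the (inhomogeneous) Hecke group associated with $q=5$. Let $G_5^5$ be the subgroup of $G_5$ generated by all elements of the form $x^5$ with $x\in G_5$, and let $G_5'=[G_5,G_5]$ be the commutator subgroup of $G_5$. Then neither $G_5^5$ nor $G_5'$ is a congruence subgroup of $G_5$; that is, there is no nonzero ideal $A$ of $\mathbb{Z}[\lambda_5]$ with $G(5,A)\subseteq G_5^5$, and there is no nonzero ideal $A$ of $\mathbb{Z}[\lambda_5]$ with $G(5,A)\subseteq G_5'$.
   Context: Let $\lambda_5 = 2\cos(\pi/5)=\frac{1+\sqrt5}{2}$. The homogeneous Hecke group $H_5$ is the subgroup of $SL_2(\mathbb{R})$ generated by $$S=\begin{pmatrix}0&1\\-1&0\end{pmatrix},\qquad T=\begin{pmatrix}1&\lambda_5\\0&1\end{pmatrix}.$$ All entries of elements of $H_5$ lie in $\mathbb{Z}[\lambda_5]$. Let $Z=\{\pm I\}\subseteq H_5$ and let $G_5=H_5/Z$ be the inhomogeneous Hecke group. For an ideal $A$ of $\mathbb{Z}[\lambda_5]$, put $$H(5,A)=\{(a_{ij})\in H_5 : a_{11}-1,\ a_{22}-1,\ a_{12},\ a_{21}\in A\},\qquad G(5,A)=H(5,A)Z/Z\subseteq G_5.$$ A subgroup $K$ of $G_5$ is called congruence if $G(5,A)\subseteq K$ for some nonzero ideal $A$ of $\mathbb{Z}[\lambda_5]$. *)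

theory Defs
  imports
    "HOL-Analysis.Analysis"
    "HOL-Algebra.Algebra"
    "HOL-Algebra.Algebraic_Closure_Type"
begin

definition lambda5 :: real where
  "lambda5 = 2 * cos (pi / 5)"

definition Z_lambda5 :: "real ring" where
  "Z_lambda5 = ring_of_type_algebra\<lparr>carrier := generate_ring ring_of_type_algebra {lambda5}\<rparr>"

definition SL2R :: "(real^2^2) monoid" where
  "SL2R = \<lparr>carrier = {M. det M = 1}, mult = (**), one = mat 1\<rparr>"

definition matS :: "real^2^2" where
  "matS = vector [vector [0, 1], vector [-1, 0]]"

definition matT :: "real^2^2" where
  "matT = vector [vector [1, lambda5], vector [0, 1]]"

definition H5 :: "(real^2^2) monoid" where
  "H5 = SL2R\<lparr>carrier := generate SL2R {matS, matT}\<rparr>"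

definition Z5 :: "(real^2^2) set" where
  "Z5 = {mat 1, - mat 1}"

definition G5 :: "(real^2^2) set monoid" where
  "G5 = H5 Mod Z5"

definition H5_level :: "real set \<Rightarrow> (real^2^2) set" where
  "H5_level A = {M \<in> carrier H5. M $ 1 $ 1 - 1 \<in> A \<and> M $ 2 $ 2 - 1 \<in> A \<and>
                                 M $ 1 $ 2 \<in> A \<and> M $ 2 $ 1 \<in> A}"

text \<open>The quotient \<open>H(5,A)Z / Z\<close>, whose elements are cosets of \<open>Z5\<close>, as a subset of
  \<open>carrier G5\<close>.\<close>

definition G5_level :: "real set \<Rightarrow> (real^2^2) set set" where
  "G5_level A = carrier (H5\<lparr>carrier := H5_level A <#>\<^bsub>H5\<^esub> Z5\<rparr> Mod Z5)"

definition congruence_subgroup :: "(real^2^2) set set \<Rightarrow> bool" where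
  "congruence_subgroup K \<longleftrightarrow>
     subgroup K G5 \<and> (\<exists>A. ideal A Z_lambda5 \<and> A \<noteq> {0} \<and> G5_level A \<subseteq> K)"

definition G5_fifth_powers :: "(real^2^2) set set" where
  "G5_fifth_powers = generate G5 {x [^]\<^bsub>G5\<^esub> (5::nat) | x. x \<in> carrier G5}"

definition G5_commutator :: "(real^2^2) set set" where
  "G5_commutator = derived G5 (carrier G5)"

lemma lambda5_eq: "lambda5 = (1 + sqrt 5) / 2"
proof -
  define c where "c = cos (pi / 5)"
  have "c > cos (pi / 2)"
    unfolding c_def by (rule cos_monotone_0_pi) auto
  then have c: "c > 0" by simp
  have "cos (3 * (pi / 5)) = - cos (2 * (pi / 5))"
    using cos_pi_minus[of "2 * (pi / 5)"] by (simp add: field_simps)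
  then have "4 * c ^ 3 - 3 * c = - (2 * c\<^sup>2 - 1)"
    using cos_treble_cos[of "pi / 5"] cos_double_cos[of "pi / 5"] by (simp add: c_def)
  then have "(c + 1) * ((4 * c - 1)\<^sup>2 - 5) = 0"
    by (simp add: algebra_simps power2_eq_square power3_eq_cube)
  with c have sq: "(4 * c - 1)\<^sup>2 = 5" by auto
  have "4 * c - 1 \<ge> 0"
  proof (rule ccontr)
    assume "\<not> 4 * c - 1 \<ge> 0"
    with c have "(4 * c - 1)\<^sup>2 < 1"
      by (intro abs_square_less_1[THEN iffD2]) auto
    with sq show False by simp
  qed
  with sq have "4 * c - 1 = sqrt 5"
    by (metis real_sqrt_unique)
  then show ?thesis
    by (simp add: lambda5_def c_def)
qed

text \<open>The library notions above are only meaningful for genuine groups and rings; the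
  following facts confirm that the structures are what they are meant to be.\<close>

lemma cring_Z_lambda5: "cring Z_lambda5"
proof -
  interpret R: cring "ring_of_type_algebra :: real ring"
    by (rule cring_from_type_algebra)
  have "subring (generate_ring ring_of_type_algebra {lambda5}) (ring_of_type_algebra :: real ring)"
    by (rule R.generate_ring_is_subring) (simp add: ring_of_type_algebra_def)
  then have "subcring (generate_ring ring_of_type_algebra {lambda5}) (ring_of_type_algebra :: real ring)"
    by (intro R.subcringI')
  then show ?thesis
    unfolding Z_lambda5_def by (rule R.subcring_iff[THEN iffD1, rotated])
      (simp add: ring_of_type_algebra_def)
qed

lemma group_SL2R: "Group.group SL2R"
proof (rule groupI)
  fix M assume M: "M \<in> carrier SL2R"
  then have "invertible M"
    by (simp add: SL2R_def invertible_det_nz)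
  then obtain N where N: "N ** M = mat 1"
    by (auto simp: invertible_def)
  then have "det N * det M = 1"
    by (metis det_mul det_I)
  with M N show "\<exists>N\<in>carrier SL2R. N \<otimes>\<^bsub>SL2R\<^esub> M = \<one>\<^bsub>SL2R\<^esub>"
    by (intro bexI[of _ N]) (auto simp: SL2R_def)
qed (auto simp: SL2R_def det_mul matrix_mul_assoc)

lemma matS_matT_in_SL2R: "{matS, matT} \<subseteq> carrier SL2R"
  by (auto simp: SL2R_def matS_def matT_def det_2)

lemma group_H5: "Group.group H5"
  unfolding H5_def
  by (intro group.subgroup_imp_group group_SL2R group.generate_is_subgroup matS_matT_in_SL2R)

lemma H5_mult: "x \<otimes>\<^bsub>H5\<^esub> y = x ** y" and H5_one: "\<one>\<^bsub>H5\<^esub> = mat 1"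
  by (simp_all add: H5_def SL2R_def)

lemma neg_mat1_mult:
  "(- mat 1) ** M = - M" "M ** (- mat 1) = - M" "(- M) ** N = - (M ** N)" for M N :: "real^2^2"
  by (simp_all add: vec_eq_iff forall_2 matrix_matrix_mult_def sum_2 mat_def)

lemma neg_mat1_in_H5: "- mat 1 \<in> carrier H5"
proof -
  have "matS ** matS = - mat 1"
    by (simp add: matS_def vec_eq_iff forall_2 matrix_matrix_mult_def sum_2 mat_def)
  moreover have "matS \<otimes>\<^bsub>SL2R\<^esub> matS \<in> generate SL2R {matS, matT}"
    by (intro generate.eng generate.incl) auto
  ultimately show ?thesis
    by (simp add: H5_def SL2R_def)
qed

lemma Z5_normal: "Z5 \<lhd> H5"
proof -
  interpret H: Group.group H5 by (rule group_H5)
  have inv_neg: "inv\<^bsub>H5\<^esub> (- mat 1) = - mat 1"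
    by (rule H.inv_equality) (use neg_mat1_in_H5 in \<open>auto simp: H5_mult H5_one neg_mat1_mult\<close>)
  have "subgroup Z5 H5"
    using neg_mat1_in_H5 H.one_closed H.inv_one inv_neg
    by (intro H.subgroupI) (auto simp: Z5_def H5_mult H5_one neg_mat1_mult)
  then show ?thesis
  proof (rule H.normal_invI)
    fix x h assume x: "x \<in> carrier H5" and h: "h \<in> Z5"
    have "x ** inv\<^bsub>H5\<^esub> x = mat 1"
      using H.r_inv[OF x] by (simp add: H5_mult H5_one)
    with h show "x \<otimes>\<^bsub>H5\<^esub> h \<otimes>\<^bsub>H5\<^esub> inv\<^bsub>H5\<^esub> x \<in> Z5"
      by (auto simp: Z5_def H5_mult neg_mat1_mult)
  qed
qed

lemma group_G5: "Group.group G5"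
  unfolding G5_def by (rule normal.factorgroup_is_group[OF Z5_normal])

lemma G5_level_eq: "G5_level A = (\<lambda>M. Z5 #>\<^bsub>H5\<^esub> M) ` H5_level A"
proof -
  have coset: "Z5 #>\<^bsub>H5\<^esub> M = {M, - M}" for M
    by (auto simp: r_coset_def Z5_def H5_mult neg_mat1_mult)
  have "G5_level A = (\<lambda>M. Z5 #>\<^bsub>H5\<^esub> M) ` (H5_level A <#>\<^bsub>H5\<^esub> Z5)"
    by (simp add: G5_level_def carrier_FactGroup r_coset_def)
  also have "H5_level A <#>\<^bsub>H5\<^esub> Z5 = H5_level A \<union> uminus ` H5_level A"
    by (auto simp: set_mult_def Z5_def H5_mult neg_mat1_mult)
  also have "(\<lambda>M. Z5 #>\<^bsub>H5\<^esub> M) ` \<dots> = (\<lambda>M. Z5 #>\<^bsub>H5\<^esub> M) ` H5_level A"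
    by (auto simp: coset insert_commute image_Un image_image)
  finally show ?thesis .
qed

lemma subgroup_G5_fifth_powers: "subgroup G5_fifth_powers G5"
  unfolding G5_fifth_powers_def
  by (rule group.generate_is_subgroup[OF group_G5])
    (auto intro!: monoid.nat_pow_closed[OF group.is_monoid[OF group_G5]])

lemma subgroup_G5_commutator: "subgroup G5_commutator G5"
  unfolding G5_commutator_def
  by (rule group.derived_is_subgroup[OF group_G5]) auto

end

theory Submission
  imports Defs
begin

text \<open>
  Modulo its centre the Hecke group is the free product of \<open>\<langle>S\<rangle>\<close> of order 2 and \<open>\<langle>U\<rangle>\<close> of order 5,
  where \<open>U = T S\<close>. So there is a homomorphism \<open>\<phi>\<close> to the integers modulo 5 with
  \<open>\<phi>(S) = 0\<close> and \<open>\<phi>(T) = 1\<close>: it counts occurrences of \<open>T\<close> in a word. Fifth powers and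
  commutators lie in its kernel, and therefore both subgroups of the theorem do. What has to be
  shown is that \<open>\<phi>\<close> is nontrivial on every principal congruence subgroup. A nonzero ideal contains
  a positive integer, so it suffices to find, for each \<open>N > 0\<close>, an element \<open>g\<close> congruent to 1
  modulo \<open>N\<close> with \<open>\<phi>(g) \<noteq> 0\<close> (lemma \<open>exp_sum_nonzero_at_every_level\<close>).

  Well-definedness of \<open>\<phi>\<close> is a ping-pong argument (\<open>exp_sum_one_dvd\<close>): up to sign the elements
  \<open>U\<^sup>k S\<close> with \<open>1 \<le> k \<le> 4\<close> are matrices with nonnegative entries and diagonal at least 1, so no
  nonempty product of them is trivial.

  Write \<open>N = 5^r m\<close> with \<open>m\<close> prime to 5 and \<open>q = 5^(r + 1)\<close>. The factor \<open>m\<close> is harmless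
  (\<open>exp_sum_crt\<close>). Choose \<open>e \<equiv> 1 (mod m)\<close> and \<open>e \<equiv> 0 (mod q)\<close>. Then \<open>T^e\<close> is \<open>T\<close> modulo
  \<open>m\<close>, is trivial modulo \<open>q\<close>, and lies in the kernel of \<open>\<phi>\<close>. The relation \<open>U^5 = 1\<close> expresses
  \<open>S\<close> through conjugates of \<open>T\<close>, which gives such a substitute for \<open>S\<close> as well. Hence every
  element of the group agrees modulo \<open>m\<close> with an element of the kernel that is trivial modulo
  \<open>q\<close>, and only powers of 5 remain.

  At powers of 5 the argument is successive approximation along powers of the ramified prime
  \<open>\<surd>5\<close>. The element \<open>z = (T\<^sup>2 S)\<^sup>3\<close> is congruent to 1 modulo \<open>\<surd>5\<close> and has \<open>\<phi>(z) = 6 \<noteq> 0\<close>. If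
  \<open>g = 1 + \<surd>5^j M\<close>, then \<open>det g = 1\<close> forces \<open>M\<close> to be traceless modulo \<open>\<surd>5\<close>. Every traceless
  matrix over the field with 5 elements is the leading coefficient at level \<open>j\<close> of an element of
  the kernel of \<open>\<phi>\<close>: at level 1 this follows from conjugates of \<open>z\<close>, and the bracket
  \<open>[H, E] = 2E\<close> carries it from level \<open>j\<close> to level \<open>j + 1\<close>. Multiplying by such elements moves
  \<open>z\<close> to any level without changing \<open>\<phi>\<close>.
\<close>

section \<open>Arithmetic of the golden ring\<close>

lemma lambda5_sq: "lambda5 * lambda5 = lambda5 + 1"
  by (simp add: lambda5_eq field_simps)

lemma lambda5_sq_left: "lambda5 * (lambda5 * x) = lambda5 * x + x"
  by (simp only: mult.assoc[symmetric] lambda5_sq) (simp add: algebra_simps)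

lemmas lambda5_simps = lambda5_sq lambda5_sq_left

lemma lambda5_ge_1: "lambda5 \<ge> 1"
  by (simp add: lambda5_eq)

lemma sqrt5_eq: "sqrt 5 = 2 * lambda5 - 1"
  by (simp add: lambda5_eq)

text \<open>
  The norm form of the ring is anisotropic because it is irreducible modulo 2: both variables of a
  zero are even, and halving them gives an infinite descent.
\<close>

lemma golden_norm_eq_0:
  fixes a b :: int
  assumes "a * a + a * b - b * b = 0"
  shows "a = 0 \<and> b = 0"
  using assms
proof (induction "nat \<bar>a\<bar> + nat \<bar>b\<bar>" arbitrary: a b rule: less_induct)
  case less
  have "even (a * a + a * b - b * b)"
    using less.prems by simp
  then have "even a" "even b"
    by auto
  then obtain c d where cd: "a = 2 * c" "b = 2 * d"
    by (auto elim!: evenE)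
  with less.prems have "4 * (c * c + c * d - d * d) = 0"
    by (simp add: algebra_simps)
  then have 0: "c * c + c * d - d * d = 0"
    by simp
  show ?case
  proof (rule ccontr)
    assume "\<not> (a = 0 \<and> b = 0)"
    then have "nat \<bar>c\<bar> + nat \<bar>d\<bar> < nat \<bar>a\<bar> + nat \<bar>b\<bar>"
      using cd by auto
    then have "c = 0 \<and> d = 0"
      using less.hyps 0 by blast
    with cd \<open>\<not> (a = 0 \<and> b = 0)\<close> show False
      by simp
  qed
qed

definition golden :: "real set" where
  "golden = {of_int a + of_int b * lambda5 | a b. True}"

lemma goldenI: "x = of_int a + of_int b * lambda5 \<Longrightarrow> x \<in> golden"
  by (auto simp: golden_def)

lemma golden_of_int [simp]: "of_int a \<in> golden"
  by (rule goldenI[of _ a 0]) simp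

lemma golden_0 [simp]: "0 \<in> golden" and golden_1 [simp]: "1 \<in> golden"
  and golden_numeral [simp]: "numeral k \<in> golden"
  using golden_of_int[of 0] golden_of_int[of 1] golden_of_int[of "numeral k"] by simp_all

lemma golden_lambda5 [simp]: "lambda5 \<in> golden"
  by (rule goldenI[of _ 0 1]) simp

lemma golden_add [simp]: "x \<in> golden \<Longrightarrow> y \<in> golden \<Longrightarrow> x + y \<in> golden"
proof -
  assume "x \<in> golden" "y \<in> golden"
  then obtain a b c d where "x = of_int a + of_int b * lambda5" "y = of_int c + of_int d * lambda5"
    by (auto simp: golden_def)
  then show ?thesis
    by (intro goldenI[of _ "a + c" "b + d"]) (simp add: algebra_simps)
qed

lemma golden_mult [simp]: "x \<in> golden \<Longrightarrow> y \<in> golden \<Longrightarrow> x * y \<in> golden"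
proof -
  assume "x \<in> golden" "y \<in> golden"
  then obtain a b c d where "x = of_int a + of_int b * lambda5" "y = of_int c + of_int d * lambda5"
    by (auto simp: golden_def)
  then show ?thesis
    by (intro goldenI[of _ "a * c + b * d" "a * d + b * c + b * d"])
       (simp add: algebra_simps lambda5_simps)
qed

lemma golden_minus [simp]: "x \<in> golden \<Longrightarrow> - x \<in> golden"
  using golden_mult[of "of_int (- 1)" x] golden_of_int[of "- 1"] by simp

lemma golden_diff [simp]: "x \<in> golden \<Longrightarrow> y \<in> golden \<Longrightarrow> x - y \<in> golden"
  using golden_add[of x "- y"] by simp

lemma golden_sqrt5 [simp]: "sqrt 5 \<in> golden"
  by (simp add: sqrt5_eq)

lemma golden_power [simp]: "x \<in> golden \<Longrightarrow> x ^ n \<in> golden"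
  by (induction n) auto

lemma carrier_Z_lambda5: "carrier Z_lambda5 = golden"
proof
  let ?R = "ring_of_type_algebra :: real ring"
  interpret R: cring ?R by (rule cring_from_type_algebra)
  have neg: "\<ominus>\<^bsub>?R\<^esub> x = - x" for x
    by (rule R.minus_equality) (simp_all add: ring_of_type_algebra_def)
  have "x \<in> golden" if "x \<in> generate_ring ?R {lambda5}" for x
    using that by induction (auto simp: neg, auto simp: ring_of_type_algebra_def)
  then show "carrier Z_lambda5 \<subseteq> golden"
    by (auto simp: Z_lambda5_def)
  have add: "x + y \<in> generate_ring ?R {lambda5}"
    if "x \<in> generate_ring ?R {lambda5}" "y \<in> generate_ring ?R {lambda5}" for x y
    using generate_ring.eng_add[OF that] by (simp add: ring_of_type_algebra_def)
  have mult: "x * y \<in> generate_ring ?R {lambda5}"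
    if "x \<in> generate_ring ?R {lambda5}" "y \<in> generate_ring ?R {lambda5}" for x y
    using generate_ring.eng_mult[OF that] by (simp add: ring_of_type_algebra_def)
  have uminus: "- x \<in> generate_ring ?R {lambda5}" if "x \<in> generate_ring ?R {lambda5}" for x
    using generate_ring.a_inv[OF that] by (simp add: neg)
  have one: "1 \<in> generate_ring ?R {lambda5}"
    using generate_ring.one[of ?R] by (simp add: ring_of_type_algebra_def)
  have zero: "0 \<in> generate_ring ?R {lambda5}"
    using add[OF one uminus[OF one]] by simp
  have nat: "of_nat n \<in> generate_ring ?R {lambda5}" for n
    by (induction n) (auto intro: zero add one)
  have int: "of_int k \<in> generate_ring ?R {lambda5}" for k
    using nat uminus by (cases k rule: int_cases2) auto
  have lambda: "lambda5 \<in> generate_ring ?R {lambda5}"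
    by (rule generate_ring.incl) simp
  show "golden \<subseteq> carrier Z_lambda5"
    by (auto simp: Z_lambda5_def golden_def intro!: add mult int lambda)
qed

lemma ideal_Z_lambda5_absorb:
  assumes "ideal A Z_lambda5" "x \<in> A" "y \<in> golden"
  shows "x * y \<in> A"
  using ideal.I_r_closed[OF assms(1,2), of y] assms(3)
  by (simp add: carrier_Z_lambda5) (simp add: Z_lambda5_def ring_of_type_algebra_def)

text \<open>
  The integer is the absolute value of the norm of a nonzero element, which is a multiple of that
  element by its conjugate.
\<close>

lemma nonzero_ideal_contains_pos_int:
  assumes A: "ideal A Z_lambda5" and "A \<noteq> {0}"
  obtains n :: int where "n > 0" "of_int n \<in> A"
proof -
  interpret ideal A Z_lambda5 by fact
  have zero: "0 \<in> A"
    using additive_subgroup.zero_closed[OF additive_subgroup_axioms]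
    by (simp add: Z_lambda5_def ring_of_type_algebra_def)
  with \<open>A \<noteq> {0}\<close> obtain x where x: "x \<in> A" "x \<noteq> 0"
    by blast
  then have "x \<in> golden"
    using additive_subgroup.a_subset[OF additive_subgroup_axioms] carrier_Z_lambda5 by auto
  then obtain a b where ab: "x = of_int a + of_int b * lambda5"
    by (auto simp: golden_def)
  define N where "N = a * a + a * b - b * b"
  have "N \<noteq> 0"
    using golden_norm_eq_0[of a b] x ab by (auto simp: N_def)
  have *: "x * (of_int a + of_int b - of_int b * lambda5) = of_int N"
    by (simp add: ab N_def algebra_simps lambda5_simps)
  have "of_int N \<in> A"
    using ideal_Z_lambda5_absorb[OF A x(1), of "of_int a + of_int b - of_int b * lambda5"] *
    by simp
  then have "of_int N * of_int (sgn N) \<in> A"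
    by (intro ideal_Z_lambda5_absorb[OF A]) auto
  then have "of_int \<bar>N\<bar> \<in> A"
    by (metis abs_sgn of_int_mult)
  with \<open>N \<noteq> 0\<close> show thesis
    by (intro that[of "\<bar>N\<bar>"]) auto
qed

section \<open>Matrices over the golden ring and their congruences\<close>

definition mx :: "real \<Rightarrow> real \<Rightarrow> real \<Rightarrow> real \<Rightarrow> real^2^2" where
  "mx a b c d = vector [vector [a, b], vector [c, d]]"

lemma mx_nth [simp]:
  "mx a b c d $ 1 $ 1 = a" "mx a b c d $ 1 $ 2 = b" "mx a b c d $ 2 $ 1 = c" "mx a b c d $ 2 $ 2 = d"
  by (simp_all add: mx_def)

lemma mx_eq_iff [simp]: "mx a b c d = mx a' b' c' d' \<longleftrightarrow> a = a' \<and> b = b' \<and> c = c' \<and> d = d'"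
  by (auto simp: vec_eq_iff forall_2)

lemma mx_cases: obtains a b c d where "M = mx a b c d"
proof
  show "M = mx (M $ 1 $ 1) (M $ 1 $ 2) (M $ 2 $ 1) (M $ 2 $ 2)"
    by (simp add: vec_eq_iff forall_2)
qed

lemma mx_arith:
  "mx a b c d ** mx a' b' c' d' = mx (a * a' + b * c') (a * b' + b * d') (c * a' + d * c') (c * b' + d * d')"
  "mx a b c d + mx a' b' c' d' = mx (a + a') (b + b') (c + c') (d + d')"
  "mx a b c d - mx a' b' c' d' = mx (a - a') (b - b') (c - c') (d - d')"
  "- mx a b c d = mx (-a) (-b) (-c) (-d)"
  "r *\<^sub>R mx a b c d = mx (r * a) (r * b) (r * c) (r * d)"
  "mat 1 = mx 1 0 0 1" "0 = mx 0 0 0 0"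
  by (simp_all add: vec_eq_iff forall_2 matrix_matrix_mult_def sum_2 mat_def)

lemma matS_eq: "matS = mx 0 1 (- 1) 0" and matT_eq: "matT = mx 1 lambda5 0 1"
  by (simp_all add: matS_def matT_def mx_def)

lemma mat2_ring:
  fixes A B C :: "real^2^2"
  shows "A ** (B + C) = A ** B + A ** C" "(A + B) ** C = A ** C + B ** C"
    "A ** (B - C) = A ** B - A ** C" "(A - B) ** C = A ** C - B ** C"
    "A ** (- B) = - (A ** B)" "(- A) ** B = - (A ** B)"
    "A ** (r *\<^sub>R B) = r *\<^sub>R (A ** B)" "(r *\<^sub>R A) ** B = r *\<^sub>R (A ** B)"
    "A ** 0 = 0" "0 ** A = 0"
  by (simp_all add: vec_eq_iff forall_2 matrix_matrix_mult_def sum_2 algebra_simps)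

text \<open>
  The two-sided ideal of the ring of matrices over the golden ring that consists of the multiples
  of \<open>r\<close>; \<open>gmat 1\<close> is the whole matrix ring.
\<close>

definition gmat :: "real \<Rightarrow> (real^2^2) set" where
  "gmat r = {r *\<^sub>R mx a b c d | a b c d. a \<in> golden \<and> b \<in> golden \<and> c \<in> golden \<and> d \<in> golden}"

lemma gmatI:
  "M = r *\<^sub>R mx a b c d \<Longrightarrow> a \<in> golden \<Longrightarrow> b \<in> golden \<Longrightarrow> c \<in> golden \<Longrightarrow> d \<in> golden \<Longrightarrow> M \<in> gmat r"
  by (auto simp: gmat_def)

lemma gmatE:
  assumes "M \<in> gmat r"
  obtains a b c d where "M = mx (r * a) (r * b) (r * c) (r * d)"
    "a \<in> golden" "b \<in> golden" "c \<in> golden" "d \<in> golden"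
  using assms by (auto simp: gmat_def mx_arith)

lemma mx_in_gmat_1 [simp]:
  "a \<in> golden \<Longrightarrow> b \<in> golden \<Longrightarrow> c \<in> golden \<Longrightarrow> d \<in> golden \<Longrightarrow> mx a b c d \<in> gmat 1"
  by (rule gmatI[of _ _ a b c d]) (auto simp: mx_arith)

lemma gmat_0 [simp]: "0 \<in> gmat r"
  by (rule gmatI[of _ _ 0 0 0 0]) (auto simp: mx_arith)

lemma gmat_one [simp]: "mat 1 \<in> gmat 1"
  by (simp add: mx_arith)

lemma gmat_add [simp]: "A \<in> gmat r \<Longrightarrow> B \<in> gmat r \<Longrightarrow> A + B \<in> gmat r"
proof (elim gmatE)
  fix a b c d a' b' c' d'
  assume "A = mx (r * a) (r * b) (r * c) (r * d)" "B = mx (r * a') (r * b') (r * c') (r * d')"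
    "a \<in> golden" "b \<in> golden" "c \<in> golden" "d \<in> golden"
    "a' \<in> golden" "b' \<in> golden" "c' \<in> golden" "d' \<in> golden"
  then show ?thesis
    by (intro gmatI[of _ _ "a + a'" "b + b'" "c + c'" "d + d'"]) (auto simp: mx_arith algebra_simps)
qed

lemma gmat_mult: "A \<in> gmat r \<Longrightarrow> B \<in> gmat s \<Longrightarrow> A ** B \<in> gmat (r * s)"
proof (elim gmatE)
  fix a b c d a' b' c' d'
  assume "A = mx (r * a) (r * b) (r * c) (r * d)" "B = mx (s * a') (s * b') (s * c') (s * d')"
    "a \<in> golden" "b \<in> golden" "c \<in> golden" "d \<in> golden"
    "a' \<in> golden" "b' \<in> golden" "c' \<in> golden" "d' \<in> golden"
  then show ?thesis
    by (intro gmatI[of _ _ "a * a' + b * c'" "a * b' + b * d'" "c * a' + d * c'" "c * b' + d * d'"])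
       (auto simp: mx_arith algebra_simps)
qed

lemma gmat_mult_left [simp]: "A \<in> gmat 1 \<Longrightarrow> B \<in> gmat r \<Longrightarrow> A ** B \<in> gmat r"
  and gmat_mult_right [simp]: "A \<in> gmat r \<Longrightarrow> B \<in> gmat 1 \<Longrightarrow> A ** B \<in> gmat r"
  using gmat_mult[of A 1 B r] gmat_mult[of A r B 1] by auto

lemma gmat_scale: "A \<in> gmat r \<Longrightarrow> s \<in> golden \<Longrightarrow> s *\<^sub>R A \<in> gmat r"
proof (elim gmatE)
  fix a b c d
  assume "A = mx (r * a) (r * b) (r * c) (r * d)" "s \<in> golden"
    "a \<in> golden" "b \<in> golden" "c \<in> golden" "d \<in> golden"
  then show ?thesis
    by (intro gmatI[of _ _ "s * a" "s * b" "s * c" "s * d"]) (auto simp: mx_arith algebra_simps)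
qed

lemma gmat_minus [simp]: "A \<in> gmat r \<Longrightarrow> - A \<in> gmat r"
  using gmat_scale[of A r "- 1"] by simp

lemma gmat_diff [simp]: "A \<in> gmat r \<Longrightarrow> B \<in> gmat r \<Longrightarrow> A - B \<in> gmat r"
  using gmat_add[of A r "- B"] by simp

lemma gmat_mono:
  assumes "A \<in> gmat (r * s)" "s \<in> golden"
  shows "A \<in> gmat r"
  using assms(1)
proof (elim gmatE)
  fix a b c d
  assume "A = mx (r * s * a) (r * s * b) (r * s * c) (r * s * d)"
    "a \<in> golden" "b \<in> golden" "c \<in> golden" "d \<in> golden"
  then show ?thesis using assms(2)
    by (intro gmatI[of _ _ "s * a" "s * b" "s * c" "s * d"]) (auto simp: mx_arith algebra_simps)
qed

definition mcong :: "real \<Rightarrow> real^2^2 \<Rightarrow> real^2^2 \<Rightarrow> bool" where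
  "mcong r A B \<longleftrightarrow> A \<in> gmat 1 \<and> B \<in> gmat 1 \<and> A - B \<in> gmat r"

lemma mcong_refl: "A \<in> gmat 1 \<Longrightarrow> mcong r A A"
  by (simp add: mcong_def)

lemma mcong_sym: "mcong r A B \<Longrightarrow> mcong r B A"
  using gmat_minus[of "A - B" r] by (simp add: mcong_def)

lemma mcong_trans [trans]: "mcong r A B \<Longrightarrow> mcong r B C \<Longrightarrow> mcong r A C"
  using gmat_add[of "A - B" r "B - C"] by (simp add: mcong_def)

lemma mcong_add: "mcong r A A' \<Longrightarrow> mcong r B B' \<Longrightarrow> mcong r (A + B) (A' + B')"
  using gmat_add[of "A - A'" r "B - B'"] by (simp add: mcong_def algebra_simps)

lemma mcong_diff: "mcong r A A' \<Longrightarrow> mcong r B B' \<Longrightarrow> mcong r (A - B) (A' - B')"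
  using gmat_diff[of "A - A'" r "B - B'"] by (simp add: mcong_def algebra_simps)

lemma mcong_mult:
  assumes "mcong r A A'" "mcong r B B'"
  shows "mcong r (A ** B) (A' ** B')"
proof -
  have "A ** B - A' ** B' = (A - A') ** B + A' ** (B - B')"
    by (simp add: mat2_ring)
  also have "\<dots> \<in> gmat r"
    using assms by (intro gmat_add gmat_mult_left gmat_mult_right) (auto simp: mcong_def)
  finally show ?thesis
    using assms by (simp add: mcong_def)
qed

lemma mcong_coprime:
  fixes m q :: int
  assumes "coprime m q" "mcong (of_int m) A B" "mcong (of_int q) A B"
  shows "mcong (of_int (m * q)) A B"
proof -
  obtain u v where uv: "u * m + v * q = 1"
    using assms(1) by (metis bezout_int coprime_iff_gcd_eq_1)
  define D where "D = A - B"
  obtain a b c d where D: "D = mx (of_int m * a) (of_int m * b) (of_int m * c) (of_int m * d)"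
    and ad: "a \<in> golden" "b \<in> golden" "c \<in> golden" "d \<in> golden"
    using assms(2) gmatE unfolding mcong_def D_def by metis
  obtain a' b' c' d' where D': "D = mx (of_int q * a') (of_int q * b') (of_int q * c') (of_int q * d')"
    and ad': "a' \<in> golden" "b' \<in> golden" "c' \<in> golden" "d' \<in> golden"
    using assms(3) gmatE unfolding mcong_def D_def by metis
  have eqs: "of_int m * a = of_int q * a'" "of_int m * b = of_int q * b'"
     "of_int m * c = of_int q * c'" "of_int m * d = of_int q * d'"
    using D D' by auto
  have *: "of_int m * x = of_int m * of_int q * (of_int u * x' + of_int v * x)"
    if "of_int m * x = of_int q * x'" for x x' :: real
  proof -
    have "of_int m * x = (of_int (u * m + v * q)) * (of_int m * x)"
      using uv by simp
    also have "\<dots> = of_int u * of_int m * (of_int m * x) + of_int v * of_int q * (of_int m * x)"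
      by (simp add: algebra_simps)
    also have "of_int u * of_int m * (of_int m * x) = of_int u * of_int m * (of_int q * x')"
      using that by simp
    finally show ?thesis
      by (simp add: algebra_simps)
  qed
  have "D \<in> gmat (of_int m * of_int q)"
    by (rule gmatI[of _ _ "of_int u * a' + of_int v * a" "of_int u * b' + of_int v * b"
          "of_int u * c' + of_int v * c" "of_int u * d' + of_int v * d"])
       (use D ad ad' *[OF eqs(1)] *[OF eqs(2)] *[OF eqs(3)] *[OF eqs(4)] in \<open>auto simp: mx_arith\<close>)
  then show ?thesis
    using assms(2) by (simp add: mcong_def D_def)
qed

section \<open>Exponent sums of words\<close>

text \<open>
  Powers of \<open>T\<close> are given by their entries, so that negative exponents need no inverse matrices.
\<close>

definition tpow :: "int \<Rightarrow> real^2^2" where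
  "tpow a = mx 1 (of_int a * lambda5) 0 1"

lemma tpow_0 [simp]: "tpow 0 = mat 1" and tpow_1: "tpow 1 = matT"
  by (simp_all add: tpow_def mx_arith matT_eq)

lemma tpow_add: "tpow a ** tpow b = tpow (a + b)"
  by (simp add: tpow_def mx_arith algebra_simps)

lemma matS_sq: "matS ** matS = - mat 1"
  by (simp add: matS_eq mx_arith)

text \<open>
  The graph of \<open>\<phi>\<close> before reduction modulo 5. It is a relation, since one element has many words
  with different exponent sums; the content of the next section is that they agree modulo 5.
\<close>

inductive exp_sum :: "real^2^2 \<Rightarrow> int \<Rightarrow> bool" where
  one: "exp_sum (mat 1) 0"
| S: "exp_sum g n \<Longrightarrow> exp_sum (matS ** g) n"
| T: "exp_sum g n \<Longrightarrow> a \<in> {1, - 1} \<Longrightarrow> exp_sum (tpow a ** g) (n + a)"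

lemma exp_sum_cong: "exp_sum g m \<Longrightarrow> m = n \<Longrightarrow> exp_sum g n"
  by simp

lemma exp_sum_mult:
  assumes "exp_sum g m" "exp_sum h n"
  shows "exp_sum (g ** h) (m + n)"
  using assms(1)
proof induction
  case (T g m a)
  then show ?case
    using exp_sum.T[of "g ** h" "m + n" a] by (simp add: matrix_mul_assoc algebra_simps)
qed (use assms(2) exp_sum.S in \<open>auto simp flip: matrix_mul_assoc\<close>)

lemma exp_sum_matS: "exp_sum matS 0"
  using exp_sum.S[OF exp_sum.one] by simp

lemma exp_sum_neg: "exp_sum g n \<Longrightarrow> exp_sum (- g) n"
  using exp_sum.S[OF exp_sum.S, of g n] by (simp add: matrix_mul_assoc matS_sq mat2_ring)

lemma exp_sum_tpow: "exp_sum (tpow a) a"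
proof (induction a rule: int_induct[where k = 0])
  case base
  show ?case using exp_sum.one by simp
next
  case (step1 i)
  then show ?case using exp_sum.T[of "tpow i" i 1] by (simp add: tpow_add add.commute)
next
  case (step2 i)
  then show ?case using exp_sum.T[of "tpow i" i "- 1"] by (simp add: tpow_add)
qed

lemma exp_sum_inverse:
  assumes "exp_sum g n"
  shows "\<exists>h. exp_sum h (- n) \<and> g ** h = mat 1 \<and> h ** g = mat 1"
  using assms
proof induction
  case one
  show ?case using exp_sum.one by (intro exI[of _ "mat 1"]) simp
next
  case (S g n)
  then obtain h where h: "exp_sum h (- n)" "g ** h = mat 1" "h ** g = mat 1"
    by blast
  have "matS ** g ** (h ** (- matS)) = matS ** (g ** h) ** (- matS)"
    "h ** (- matS) ** (matS ** g) = h ** (- matS ** matS) ** g"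
    by (simp_all only: matrix_mul_assoc)
  then show ?case
    using h exp_sum_mult[OF h(1) exp_sum_neg[OF exp_sum_matS]]
    by (intro exI[of _ "h ** (- matS)"]) (simp add: mat2_ring matS_sq)
next
  case (T g n a)
  then obtain h where h: "exp_sum h (- n)" "g ** h = mat 1" "h ** g = mat 1"
    by blast
  have "tpow a ** g ** (h ** tpow (- a)) = tpow a ** (g ** h) ** tpow (- a)"
    "h ** tpow (- a) ** (tpow a ** g) = h ** (tpow (- a) ** tpow a) ** g"
    by (simp_all only: matrix_mul_assoc)
  then show ?case
    using h exp_sum_mult[OF h(1) exp_sum_tpow[of "- a"]]
    by (intro exI[of _ "h ** tpow (- a)"]) (simp add: tpow_add)
qed

lemma gmat_tpow [simp]: "tpow a \<in> gmat 1" and gmat_matS [simp]: "matS \<in> gmat 1"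
  by (simp_all add: tpow_def matS_eq)

lemma exp_sum_gmat: "exp_sum g n \<Longrightarrow> g \<in> gmat 1"
  by (induction rule: exp_sum.induct) simp_all

lemma exp_sum_det: "exp_sum g n \<Longrightarrow> det g = 1"
  by (induction rule: exp_sum.induct) (simp_all add: det_mul, simp_all add: tpow_def matS_eq det_2)

lemma carrier_H5_eq: "carrier H5 = generate SL2R {matS, matT}"
  by (simp add: H5_def)

lemma exp_sum_imp_H5:
  assumes "exp_sum g n"
  shows "g \<in> carrier H5"
proof -
  interpret SL: group SL2R by (rule group_SL2R)
  have eng: "a ** b \<in> carrier H5" if "a \<in> carrier H5" "b \<in> carrier H5" for a b
    using that generate.eng[of a SL2R "{matS, matT}" b] by (simp add: carrier_H5_eq SL2R_def)
  have S: "matS \<in> carrier H5" and T: "tpow 1 \<in> carrier H5"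
    by (auto simp: carrier_H5_eq tpow_1 intro: generate.incl)
  have "inv\<^bsub>SL2R\<^esub> matT = tpow (- 1)"
    by (rule SL.inv_equality) (auto simp: SL2R_def tpow_def matT_eq mx_arith det_2)
  then have T': "tpow (- 1) \<in> carrier H5"
    using generate.inv[of matT "{matS, matT}" SL2R] by (simp add: carrier_H5_eq)
  show ?thesis
    using assms
  proof induction
    case one
    show ?case using group.is_monoid[OF group_H5, THEN monoid.one_closed] by (simp add: H5_one)
  qed (use eng S T T' in auto)
qed

lemma H5_imp_exp_sum:
  assumes "g \<in> carrier H5"
  shows "\<exists>n. exp_sum g n"
  using assms unfolding carrier_H5_eq
proof induction
  case one
  show ?case using exp_sum.one by (auto simp: SL2R_def)
next
  case (incl h)
  then show ?case using exp_sum_matS exp_sum_tpow[of 1] by (auto simp: tpow_1)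
next
  case (inv h)
  then obtain n where n: "exp_sum h n"
    using exp_sum_matS exp_sum_tpow[of 1] by (auto simp: tpow_1)
  then obtain h' where h': "exp_sum h' (- n)" "h' ** h = mat 1"
    using exp_sum_inverse by blast
  have "inv\<^bsub>SL2R\<^esub> h = h'"
    using h' n by (intro group.inv_equality[OF group_SL2R]) (auto simp: SL2R_def exp_sum_det)
  with h' show ?case by auto
next
  case (eng h1 h2)
  then show ?case using exp_sum_mult by (fastforce simp: SL2R_def)
qed

section \<open>The exponent sum modulo 5 is well defined\<close>

text \<open>
  The matrices \<open>\<plusminus>U\<^sup>k S\<close> for \<open>k = 1, \<dots>, 4\<close>, with signs chosen to make the entries nonnegative. The
  second component \<open>k\<close> is the exponent sum modulo 5, because \<open>U = T S\<close> contains one \<open>T\<close>.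
\<close>

definition blocks :: "((real^2^2) \<times> int) set" where
  "blocks = {(mx 1 lambda5 0 1, 1), (mx lambda5 lambda5 1 lambda5, 2),
             (mx lambda5 1 lambda5 lambda5, 3), (mx 1 0 lambda5 1, 4)}"

text \<open>
  The powers \<open>U\<^sup>0, \<dots>, U\<^sup>4\<close> with their exponents.
\<close>

definition tails :: "((real^2^2) \<times> int) set" where
  "tails = {(mat 1, 0), (mx (- lambda5) 1 (- 1) 0, 1), (mx lambda5 (- lambda5) lambda5 (- 1), 2),
            (mx (- 1) lambda5 (- lambda5) lambda5, 3), (mx 0 (- 1) 1 (- lambda5), 4)}"

inductive block_prod :: "real^2^2 \<Rightarrow> int \<Rightarrow> bool" where
  one: "block_prod (mat 1) 0"
| step: "block_prod P p \<Longrightarrow> (A, k) \<in> blocks \<Longrightarrow> block_prod (A ** P) (p + k)"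

text \<open>
  The normal form of the free product, up to sign: an optional \<open>S\<close>, then a product of blocks
  \<open>U\<^sup>k S\<close>, then a power of \<open>U\<close>.
\<close>

definition normal_form :: "real^2^2 \<Rightarrow> int \<Rightarrow> bool" where
  "normal_form g n \<longleftrightarrow> (\<exists>P p V i. block_prod P p \<and> (V, i) \<in> tails \<and> 5 dvd (n - p - i) \<and>
     (g = P ** V \<or> g = - (P ** V) \<or> g = matS ** (P ** V) \<or> g = - (matS ** (P ** V))))"

lemma normal_form_neg: "normal_form g n \<Longrightarrow> normal_form (- g) n"
  unfolding normal_form_def by (metis minus_minus)

lemma normal_form_matS: "normal_form g n \<Longrightarrow> normal_form (matS ** g) n"
proof -
  have *: "matS ** (matS ** M) = - M" for M :: "real^2^2"
    by (simp add: matrix_mul_assoc matS_sq mat2_ring)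
  show "normal_form g n \<Longrightarrow> normal_form (matS ** g) n"
    unfolding normal_form_def by (metis * mat2_ring(5) minus_minus)
qed

definition matU :: "real^2^2" where
  "matU = mx (- lambda5) 1 (- 1) 0"

text \<open>
  Up to sign, multiplying the block \<open>U\<^sup>k S\<close> by \<open>U\<close> gives the next block, and the last one becomes \<open>U\<^sup>5 S = S\<close>, the optional \<open>S\<close> of the normal form.
\<close>

lemma matU_block:
  assumes "(A, k) \<in> blocks"
  shows "k = 4 \<and> matU ** A = matS \<or> (\<exists>B. (B, k + 1) \<in> blocks \<and> matU ** A = - B)"
proof -
  have mult: "matU ** mx 1 lambda5 0 1 = - mx lambda5 lambda5 1 lambda5"
    "matU ** mx lambda5 lambda5 1 lambda5 = - mx lambda5 1 lambda5 lambda5"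
    "matU ** mx lambda5 1 lambda5 lambda5 = - mx 1 0 lambda5 1"
    "matU ** mx 1 0 lambda5 1 = matS"
    by (simp_all add: matU_def matS_eq mx_arith lambda5_sq)
  have "(A, k) = (mx 1 lambda5 0 1, 1) \<or> (A, k) = (mx lambda5 lambda5 1 lambda5, 2) \<or>
      (A, k) = (mx lambda5 1 lambda5 lambda5, 3) \<or> (A, k) = (mx 1 0 lambda5 1, 4)"
    using assms by (simp add: blocks_def)
  then show ?thesis
    by (elim disjE) (auto simp: mult blocks_def intro: exI[of _ "mx lambda5 lambda5 1 lambda5"]
        exI[of _ "mx lambda5 1 lambda5 lambda5"] exI[of _ "mx 1 0 lambda5 1"])
qed

lemma matU_tail:
  assumes "(V, i) \<in> tails"
  shows "\<exists>j. (matU ** V, j) \<in> tails \<and> 5 dvd (i + 1 - j)"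
proof -
  have mult: "matU ** mat 1 = mx (- lambda5) 1 (- 1) 0"
    "matU ** mx (- lambda5) 1 (- 1) 0 = mx lambda5 (- lambda5) lambda5 (- 1)"
    "matU ** mx lambda5 (- lambda5) lambda5 (- 1) = mx (- 1) lambda5 (- lambda5) lambda5"
    "matU ** mx (- 1) lambda5 (- lambda5) lambda5 = mx 0 (- 1) 1 (- lambda5)"
    "matU ** mx 0 (- 1) 1 (- lambda5) = mat 1"
    by (simp_all add: matU_def mx_arith lambda5_sq)
  have "(V, i) = (mat 1, 0) \<or> (V, i) = (mx (- lambda5) 1 (- 1) 0, 1) \<or>
      (V, i) = (mx lambda5 (- lambda5) lambda5 (- 1), 2) \<or>
      (V, i) = (mx (- 1) lambda5 (- lambda5) lambda5, 3) \<or> (V, i) = (mx 0 (- 1) 1 (- lambda5), 4)"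
    using assms by (simp add: tails_def)
  then show ?thesis
    by (intro exI[of _ "(i + 1) mod 5"], elim disjE)
       (simp_all add: mult, simp_all add: tails_def mx_arith matU_def)
qed

lemma matU_matS: "matU ** matS = - tpow 1"
  by (simp add: matU_def matS_eq tpow_def mx_arith)

lemma normal_form_matU:
  assumes "normal_form g n"
  shows "normal_form (matU ** g) (n + 1)"
proof -
  obtain P p V i where P: "block_prod P p" and V: "(V, i) \<in> tails" and n: "5 dvd (n - p - i)"
    and g: "g = P ** V \<or> g = - (P ** V) \<or> g = matS ** (P ** V) \<or> g = - (matS ** (P ** V))"
    using assms unfolding normal_form_def by blast
  have 1: "normal_form (matU ** (matS ** (P ** V))) (n + 1)"
  proof -
    have "block_prod (tpow 1 ** P) (p + 1)"
      by (rule block_prod.step[OF P]) (simp add: blocks_def tpow_def)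
    moreover have "matU ** (matS ** (P ** V)) = - (tpow 1 ** P ** V)"
      by (simp add: matrix_mul_assoc matU_matS mat2_ring)
    ultimately show ?thesis
      using V n unfolding normal_form_def by (smt (verit, best))
  qed
  have 2: "normal_form (matU ** (P ** V)) (n + 1)"
    using P
  proof cases
    case one
    obtain j where j: "(matU ** V, j) \<in> tails" "5 dvd (i + 1 - j)"
      using matU_tail[OF V] by blast
    have "5 dvd ((n - p - i) + (i + 1 - j))"
      by (rule dvd_add[OF n j(2)])
    then have "5 dvd (n + 1 - p - j)"
      by (simp add: algebra_simps)
    then show ?thesis
      unfolding normal_form_def using j P one by (intro exI[of _ P] exI[of _ p] exI[of _ "matU ** V"] exI[of _ j]) auto
  next
    case (step P' p' A k)
    from matU_block[OF step(4)] show ?thesis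
    proof (elim disjE conjE exE)
      assume k: "k = 4" "matU ** A = matS"
      have "matU ** (P ** V) = matS ** (P' ** V)"
        by (simp add: step matrix_mul_assoc k)
      moreover have "5 dvd (n - p - i + 5)"
        by (rule dvd_add[OF n]) simp
      then have "5 dvd (n + 1 - p' - i)"
        by (simp add: step k algebra_simps)
      ultimately show ?thesis
        unfolding normal_form_def using step V by blast
    next
      fix B assume B: "(B, k + 1) \<in> blocks" "matU ** A = - B"
      have "matU ** (P ** V) = - (B ** P' ** V)"
        by (simp add: step matrix_mul_assoc B mat2_ring)
      moreover have "block_prod (B ** P') (p' + (k + 1))"
        by (rule block_prod.step[OF step(3) B(1)])
      moreover have "5 dvd (n + 1 - (p' + (k + 1)) - i)"
        using n by (simp add: step algebra_simps)
      ultimately show ?thesis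
        unfolding normal_form_def using V by blast
    qed
  qed
  show ?thesis
    using g 1 2 normal_form_neg by (auto simp: mat2_ring)
qed

lemma normal_form_mod_5: "normal_form g m \<Longrightarrow> 5 dvd (n - m) \<Longrightarrow> normal_form g n"
proof -
  assume "normal_form g m" and d: "5 dvd (n - m)"
  then obtain P p V i where P: "block_prod P p" and V: "(V, i) \<in> tails" and n: "5 dvd (m - p - i)"
    and g: "g = P ** V \<or> g = - (P ** V) \<or> g = matS ** (P ** V) \<or> g = - (matS ** (P ** V))"
    unfolding normal_form_def by blast
  have "5 dvd (n - p - i)"
    using dvd_add[OF d n] by (simp add: algebra_simps)
  then show ?thesis
    unfolding normal_form_def using P V g by blast
qed

lemma exp_sum_normal_form: "exp_sum g n \<Longrightarrow> normal_form g n"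
proof (induction rule: exp_sum.induct)
  case one
  have "block_prod (mat 1) 0" "(mat 1, 0) \<in> tails"
    by (auto simp: tails_def intro: block_prod.one)
  then show ?case
    unfolding normal_form_def by fastforce
next
  case (S g n)
  show ?case by (rule normal_form_matS[OF S.IH])
next
  case (T g n a)
  have plus: "normal_form (tpow 1 ** g) (n + 1)"
    using normal_form_neg[OF normal_form_matU[OF normal_form_matS[OF T.IH]]]
    by (simp add: matrix_mul_assoc matU_matS mat2_ring)
  \<comment> \<open>\<open>T\<inverse> = S U\<inverse>\<close> and \<open>U\<inverse> = U\<^sup>4\<close>, whose exponent sum 4 is \<open>- 1\<close> modulo 5\<close>
  have "tpow (- 1) = matS ** (matU ** (matU ** (matU ** matU)))"
    by (simp add: tpow_def matS_eq matU_def mx_arith lambda5_simps algebra_simps)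
  then have "tpow (- 1) ** g = matS ** (matU ** (matU ** (matU ** (matU ** g))))"
    by (simp only: matrix_mul_assoc)
  then have "normal_form (tpow (- 1) ** g) (n + 1 + 1 + 1 + 1)"
    using normal_form_matS[OF normal_form_matU[OF normal_form_matU[OF normal_form_matU[OF normal_form_matU[OF T.IH]]]]]
    by simp
  then have "normal_form (tpow (- 1) ** g) (n + (- 1))"
    by (rule normal_form_mod_5) simp
  with plus T.hyps(2) show ?case
    by auto
qed

text \<open>
  A positivity property that products preserve and that no element of \<open>{\<plusminus>1, \<plusminus>S}\<close> has. The
  condition on the off-diagonal sum excludes the identity.
\<close>

definition dominating :: "real^2^2 \<Rightarrow> bool" where
  "dominating M \<longleftrightarrow> M $ 1 $ 1 \<ge> 1 \<and> M $ 2 $ 2 \<ge> 1 \<and> M $ 1 $ 2 \<ge> 0 \<and> M $ 2 $ 1 \<ge> 0 \<and>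
     M $ 1 $ 2 + M $ 2 $ 1 > 0"

lemma dominating_mx:
  "dominating (mx a b c d) \<longleftrightarrow> a \<ge> 1 \<and> d \<ge> 1 \<and> b \<ge> 0 \<and> c \<ge> 0 \<and> b + c > 0"
  by (auto simp: dominating_def)

lemma dominating_mult:
  assumes "dominating M" "dominating N"
  shows "dominating (M ** N)"
proof -
  obtain a b c d where M: "M = mx a b c d" by (rule mx_cases)
  obtain a' b' c' d' where N: "N = mx a' b' c' d'" by (rule mx_cases)
  have h: "a \<ge> 1" "d \<ge> 1" "b \<ge> 0" "c \<ge> 0" "b + c > 0"
    "a' \<ge> 1" "d' \<ge> 1" "b' \<ge> 0" "c' \<ge> 0" "b' + c' > 0"
    using assms by (auto simp: M N dominating_mx)
  have p: "a * a' \<ge> 1" "d * d' \<ge> 1" "a * b' \<ge> b'" "b * d' \<ge> b" "c * a' \<ge> c" "d * c' \<ge> c'"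
    "b * c' \<ge> 0" "c * b' \<ge> 0"
    using h mult_mono[of 1 a 1 a'] mult_mono[of 1 d 1 d'] mult_right_mono[of 1 a b']
      mult_left_mono[of 1 d' b] mult_left_mono[of 1 a' c] mult_right_mono[of 1 d c'] by auto
  show ?thesis
    unfolding M N mx_arith dominating_mx by (intro conjI) (use h p in linarith)+
qed

lemma dominating_block: "(A, k) \<in> blocks \<Longrightarrow> dominating A"
  using lambda5_ge_1 by (auto simp: blocks_def dominating_mx)

lemma block_prod_dominating: "block_prod P p \<Longrightarrow> P = mat 1 \<and> p = 0 \<or> dominating P"
  by (induction rule: block_prod.induct) (auto dest: dominating_block dominating_mult)

lemma dominating_not_trivial:
  assumes "dominating M"
  shows "M \<noteq> mat 1" "M \<noteq> - mat 1" "M \<noteq> matS" "M \<noteq> - matS"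
  using assms by (auto simp: dominating_mx mx_arith matS_eq)

text \<open>
  A nontrivial tail becomes a block after multiplication by \<open>S\<close> on the right. This lets a word
  with a tail be compared with a product of blocks.
\<close>

lemma tail_matS:
  assumes "(V, i) \<in> tails" "i \<noteq> 0"
  shows "\<exists>A k. (A, k) \<in> blocks \<and> (V ** matS = A \<or> V ** matS = - A)"
  using assms by (auto simp: tails_def blocks_def mx_arith matS_eq)

text \<open>
  In a normal form of the identity the part after the optional \<open>S\<close> lies in \<open>{\<plusminus>1, \<plusminus>S}\<close>, and this
  set is stable under multiplication by \<open>S\<close>. A nontrivial tail or a nonempty product of blocks would
  put a dominating matrix into that set.
\<close>

theorem exp_sum_one_dvd:
  assumes "exp_sum (mat 1) n"
  shows "5 dvd n"
proof -
  obtain P p V i where P: "block_prod P p" and V: "(V, i) \<in> tails" and n: "5 dvd (n - p - i)"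
    and "mat 1 = P ** V \<or> mat 1 = - (P ** V) \<or> mat 1 = matS ** (P ** V) \<or> mat 1 = - (matS ** (P ** V))"
    using exp_sum_normal_form[OF assms] unfolding normal_form_def by blast
  moreover have "M = - (matS ** (matS ** M))" for M :: "real^2^2"
    by (simp add: matrix_mul_assoc matS_sq mat2_ring)
  ultimately have PV: "P ** V \<in> {mat 1, - mat 1, matS, - matS}"
    by (metis (no_types, lifting) insertCI mat2_ring(5) matrix_mul_rid minus_minus)
  have "i = 0"
  proof (rule ccontr)
    assume "i \<noteq> 0"
    then obtain A k where A: "(A, k) \<in> blocks" "V ** matS = A \<or> V ** matS = - A"
      using tail_matS[OF V] by blast
    have "P ** A = P ** V ** matS \<or> P ** A = - (P ** V ** matS)"
      using A(2) by (metis matrix_mul_assoc mat2_ring(5) minus_minus)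
    then have "P ** A \<in> {mat 1, - mat 1, matS, - matS}"
      using PV by (auto simp: matS_sq mat2_ring)
    moreover have "dominating (P ** A)"
      using block_prod_dominating[OF P] dominating_block[OF A(1)] dominating_mult by auto
    ultimately show False
      using dominating_not_trivial by blast
  qed
  then have "V = mat 1"
    using V by (auto simp: tails_def)
  then have "p = 0"
    using PV block_prod_dominating[OF P] dominating_not_trivial by auto
  with n \<open>i = 0\<close> show ?thesis by simp
qed

lemma exp_sum_unique:
  assumes "exp_sum g m" "exp_sum g n"
  shows "5 dvd (m - n)"
proof -
  obtain h where "exp_sum h (- n)" "g ** h = mat 1"
    using exp_sum_inverse[OF assms(2)] by blast
  with exp_sum_mult[OF assms(1), of h "- n"] show ?thesis
    by (auto intro: exp_sum_one_dvd)
qed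

section \<open>Successive approximation at the prime above 5\<close>

text \<open>
  \<open>lead j n M\<close> says that some element of the group with \<open>\<phi>\<close>-value \<open>n\<close> has the form
  \<open>1 + \<surd>5^j M + \<dots>\<close>, so that \<open>M\<close> matters only modulo \<open>\<surd>5\<close>. For fixed \<open>j \<ge> 1\<close> the pairs \<open>(n, M)\<close>
  form an additive group, stable under conjugation.
\<close>

definition lead :: "nat \<Rightarrow> int \<Rightarrow> real^2^2 \<Rightarrow> bool" where
  "lead j n M \<longleftrightarrow> (\<exists>g m M'. exp_sum g m \<and> 5 dvd (m - n) \<and> g = mat 1 + sqrt 5 ^ j *\<^sub>R M' \<and>
     mcong (sqrt 5) M' M)"

lemma lead_gmat: "lead j n M \<Longrightarrow> M \<in> gmat 1"
  by (auto simp: lead_def mcong_def)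

lemma lead_mcong: "lead j n M \<Longrightarrow> mcong (sqrt 5) M N \<Longrightarrow> lead j n N"
  unfolding lead_def using mcong_trans by blast

lemma lead_mod_5: "lead j m M \<Longrightarrow> 5 dvd (m - n) \<Longrightarrow> lead j n M"
  unfolding lead_def by (smt (verit, ccfv_threshold) dvd_add)

lemma lead_zero: "lead j 0 0"
  unfolding lead_def using exp_sum.one by (intro exI[of _ "mat 1"] exI[of _ 0]) (auto simp: mcong_refl)

lemma gmat_sqrt5_scale: "M \<in> gmat 1 \<Longrightarrow> sqrt 5 *\<^sub>R M \<in> gmat (sqrt 5)"
  by (elim gmatE) (auto simp: mx_arith intro!: gmatI)

lemma mcong_sqrt5_power:
  assumes "M \<in> gmat 1" "N \<in> gmat 1" "j \<ge> 1"
  shows "mcong (sqrt 5) (M + sqrt 5 ^ j *\<^sub>R N) M"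
proof -
  have "sqrt 5 ^ j *\<^sub>R N = sqrt 5 *\<^sub>R (sqrt 5 ^ (j - 1) *\<^sub>R N)"
    using assms(3) by (cases j) auto
  also have "\<dots> \<in> gmat (sqrt 5)"
    using assms(2) by (intro gmat_sqrt5_scale gmat_scale) auto
  finally show ?thesis
    using assms by (simp add: mcong_def gmat_scale)
qed

lemma lead_add:
  assumes "lead j m M" "lead j n N" "j \<ge> 1"
  shows "lead j (m + n) (M + N)"
proof -
  obtain g m' M' where g: "exp_sum g m'" "5 dvd (m' - m)" "g = mat 1 + sqrt 5 ^ j *\<^sub>R M'"
    "mcong (sqrt 5) M' M"
    using assms(1) unfolding lead_def by blast
  obtain h n' N' where h: "exp_sum h n'" "5 dvd (n' - n)" "h = mat 1 + sqrt 5 ^ j *\<^sub>R N'"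
    "mcong (sqrt 5) N' N"
    using assms(2) unfolding lead_def by blast
  have [simp]: "M' \<in> gmat 1" "N' \<in> gmat 1"
    using g h by (auto simp: mcong_def)
  have "g ** h = mat 1 + sqrt 5 ^ j *\<^sub>R (M' + N' + sqrt 5 ^ j *\<^sub>R (M' ** N'))"
    by (simp add: g h mat2_ring algebra_simps)
  moreover have "mcong (sqrt 5) (M' + N' + sqrt 5 ^ j *\<^sub>R (M' ** N')) (M' + N')"
    using assms(3) by (intro mcong_sqrt5_power) auto
  then have "mcong (sqrt 5) (M' + N' + sqrt 5 ^ j *\<^sub>R (M' ** N')) (M + N)"
    using mcong_add[OF g(4) h(4)] mcong_trans by blast
  moreover have "5 dvd (m' + n' - (m + n))"
    using dvd_add[OF g(2) h(2)] by (simp add: algebra_simps)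
  ultimately show ?thesis
    unfolding lead_def using exp_sum_mult[OF g(1) h(1)] by blast
qed

lemma lead_nat_mult:
  assumes "lead j n M" "j \<ge> 1"
  shows "lead j (int k * n) (of_nat k *\<^sub>R M)"
proof (induction k)
  case 0
  show ?case using lead_zero by simp
next
  case (Suc k)
  show ?case
    using lead_add[OF assms(1) Suc assms(2)] by (simp add: algebra_simps)
qed

lemma mcong_sqrt5_int:
  assumes "M \<in> gmat 1" "5 dvd (k - l)"
  shows "mcong (sqrt 5) (of_int k *\<^sub>R M) (of_int l *\<^sub>R M)"
proof -
  obtain t where t: "k = l + 5 * t"
    using assms(2) by (metis add.commute diff_add_cancel dvdE)
  have "of_int k *\<^sub>R M - of_int l *\<^sub>R M = sqrt 5 *\<^sub>R ((sqrt 5 * of_int t) *\<^sub>R M)"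
    by (simp add: t algebra_simps)
  also have "\<dots> \<in> gmat (sqrt 5)"
    using assms(1) by (intro gmat_sqrt5_scale gmat_scale) auto
  finally show ?thesis
    using assms(1) by (simp add: mcong_def gmat_scale)
qed

lemma lead_int_mult:
  assumes "lead j n M" "j \<ge> 1"
  shows "lead j (k * n) (of_int k *\<^sub>R M)"
proof -
  \<comment> \<open>a negative multiple is replaced by a nonnegative one in the same residue class\<close>
  define r where "r = nat (k mod 5)"
  have r: "int r = k mod 5"
    by (simp add: r_def)
  have "5 dvd (k mod 5 - k)"
    by presburger
  then have "5 dvd (int r - k)"
    by (simp add: r)
  have "lead j (int r * n) (of_int (int r) *\<^sub>R M)"
    using lead_nat_mult[OF assms, of r] by simp
  moreover have "5 dvd (int r * n - k * n)"
    using \<open>5 dvd (int r - k)\<close> by (metis dvd_mult2 left_diff_distrib)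
  ultimately show ?thesis
    using lead_mod_5 lead_mcong mcong_sqrt5_int[OF lead_gmat[OF assms(1)] \<open>5 dvd (int r - k)\<close>] by blast
qed

lemma lead_conj:
  assumes "lead j n M" "exp_sum k a" "exp_sum k' (- a)" "k ** k' = mat 1"
  shows "lead j n (k ** M ** k')"
proof -
  obtain g m M' where g: "exp_sum g m" "5 dvd (m - n)" "g = mat 1 + sqrt 5 ^ j *\<^sub>R M'"
    "mcong (sqrt 5) M' M"
    using assms(1) unfolding lead_def by blast
  have "exp_sum (k ** g ** k') (a + m + - a)"
    using assms g by (intro exp_sum_mult)
  then have "exp_sum (k ** g ** k') m"
    by simp
  moreover have "k ** g ** k' = mat 1 + sqrt 5 ^ j *\<^sub>R (k ** M' ** k')"
    by (simp add: g mat2_ring assms(4))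
  moreover have "mcong (sqrt 5) (k ** M' ** k') (k ** M ** k')"
    using assms(2,3) g(4) by (intro mcong_mult mcong_refl) (auto intro: exp_sum_gmat)
  ultimately show ?thesis
    unfolding lead_def using g(2) by blast
qed

text \<open>
  With \<open>g = 1 + \<surd>5^i M\<close> and \<open>h = 1 + \<surd>5^j N\<close> one has \<open>g h - h g = \<surd>5^(i + j) (M N - N M)\<close>. Hence the
  group commutator is \<open>1 + \<surd>5^(i + j) (M N - N M) g\<inverse> h\<inverse>\<close>, and the last two factors are trivial modulo
  \<open>\<surd>5\<close>. Its exponent sum is 0 since \<open>\<phi>\<close> has abelian values.
\<close>

lemma lead_commutator:
  assumes "lead i m M" "lead j n N" "i \<ge> 1" "j \<ge> 1"
  shows "lead (i + j) 0 (M ** N - N ** M)"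
proof -
  obtain g m' M' where g: "exp_sum g m'" "g = mat 1 + sqrt 5 ^ i *\<^sub>R M'" "mcong (sqrt 5) M' M"
    using assms(1) unfolding lead_def by blast
  obtain h n' N' where h: "exp_sum h n'" "h = mat 1 + sqrt 5 ^ j *\<^sub>R N'" "mcong (sqrt 5) N' N"
    using assms(2) unfolding lead_def by blast
  obtain g' where g': "exp_sum g' (- m')" "g ** g' = mat 1"
    using exp_sum_inverse[OF g(1)] by blast
  obtain h' where h': "exp_sum h' (- n')" "h ** h' = mat 1"
    using exp_sum_inverse[OF h(1)] by blast
  have [simp]: "M' \<in> gmat 1" "N' \<in> gmat 1" "g' \<in> gmat 1" "h' \<in> gmat 1"
    using g h g' h' by (auto simp: mcong_def exp_sum_gmat)
  define C where "C = M' ** N' - N' ** M'"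
  have C [simp]: "C \<in> gmat 1"
    by (simp add: C_def)
  have "g ** h = h ** g + sqrt 5 ^ (i + j) *\<^sub>R C"
    by (simp add: g(2) h(2) C_def mat2_ring power_add algebra_simps)
  moreover have "h ** g ** (g' ** h') = h ** (g ** g') ** h'"
    by (simp only: matrix_mul_assoc)
  ultimately have eq: "g ** h ** (g' ** h') = mat 1 + sqrt 5 ^ (i + j) *\<^sub>R (C ** (g' ** h'))"
    by (simp add: mat2_ring g' h')
  have "mcong (sqrt 5) g (mat 1)" "mcong (sqrt 5) h (mat 1)"
    unfolding g(2) h(2) using assms(3,4) by (intro mcong_sqrt5_power; simp)+
  from mcong_mult[OF this(1) mcong_refl[of g']] mcong_mult[OF this(2) mcong_refl[of h']]
  have "mcong (sqrt 5) g' (mat 1)" "mcong (sqrt 5) h' (mat 1)"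
    by (simp_all add: g' h' mcong_sym)
  from mcong_mult[OF mcong_refl[OF C] mcong_mult[OF this]]
  have "mcong (sqrt 5) (C ** (g' ** h')) C"
    by simp
  moreover have "mcong (sqrt 5) C (M ** N - N ** M)"
    unfolding C_def by (intro mcong_diff mcong_mult g h)
  ultimately have "mcong (sqrt 5) (C ** (g' ** h')) (M ** N - N ** M)"
    by (rule mcong_trans)
  moreover have "exp_sum (g ** h ** (g' ** h')) (m' + n' + (- m' + - n'))"
    by (intro exp_sum_mult g h g' h')
  then have "exp_sum (g ** h ** (g' ** h')) 0"
    by simp
  ultimately show ?thesis
    unfolding lead_def using eq
    by (intro exI[of _ "g ** h ** (g' ** h')"] exI[of _ 0] exI[of _ "C ** (g' ** h')"]) auto
qed

abbreviation "matE \<equiv> mx 0 1 0 0"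
abbreviation "matF \<equiv> mx 0 0 1 0"
abbreviation "matH \<equiv> mx 1 0 0 (- 1)"

lemma mcong_sqrt5_mx:
  assumes "\<exists>x\<in>golden. a - a' = sqrt 5 * x" "\<exists>x\<in>golden. b - b' = sqrt 5 * x"
    "\<exists>x\<in>golden. c - c' = sqrt 5 * x" "\<exists>x\<in>golden. d - d' = sqrt 5 * x"
    "a \<in> golden" "b \<in> golden" "c \<in> golden" "d \<in> golden"
    "a' \<in> golden" "b' \<in> golden" "c' \<in> golden" "d' \<in> golden"
  shows "mcong (sqrt 5) (mx a b c d) (mx a' b' c' d')"
  using assms unfolding mcong_def by (auto simp: mx_arith intro!: gmatI)

text \<open>
  The residue field at \<open>\<surd>5\<close> is the prime field, because \<open>\<lambda> \<equiv> 3\<close> there.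
\<close>

lemma golden_residue:
  assumes "x \<in> golden"
  obtains k :: int and y where "y \<in> golden" "x = of_int k + sqrt 5 * y"
proof -
  obtain a b where "x = of_int a + of_int b * lambda5"
    using assms by (auto simp: golden_def)
  then have "x = of_int (a + 3 * b) + sqrt 5 * (of_int b * (1 - lambda5))"
    by (simp add: sqrt5_eq algebra_simps lambda5_simps)
  then show thesis
    by (rule that[rotated]) simp
qed

text \<open>
  Conjugation by the group acts irreducibly on traceless matrices modulo \<open>\<surd>5\<close>: conjugating \<open>E\<close> by
  \<open>S\<close> gives \<open>- F\<close>, and conjugating \<open>F\<close> by \<open>T\<close> gives \<open>F + 3 H - 9 E\<close>, from which \<open>H\<close> is
  recovered.
\<close>

lemma lead_E_imp_traceless:
  fixes a b c :: int
  assumes E: "lead j 0 matE" and j: "j \<ge> 1"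
  shows "lead j 0 (mx (of_int a) (of_int b) (of_int c) (- of_int a))"
proof -
  have "lead j 0 (matS ** matE ** (- matS))"
    by (rule lead_conj[OF E, where a = 0])
       (use exp_sum_matS exp_sum_neg[OF exp_sum_matS] in \<open>auto simp: mat2_ring matS_sq\<close>)
  from lead_int_mult[OF this j, of "- 1"] have F: "lead j 0 matF"
    by (simp add: matS_eq mx_arith)
  have "lead j 0 (tpow 1 ** matF ** tpow (- 1))"
    by (rule lead_conj[OF F exp_sum_tpow]) (use exp_sum_tpow[of "- 1"] in \<open>auto simp: tpow_add\<close>)
  then have "lead j 0 (mx lambda5 (- (lambda5 + 1)) 1 (- lambda5))"
    by (simp add: tpow_def mx_arith lambda5_sq)
  moreover have "mcong (sqrt 5) (mx lambda5 (- (lambda5 + 1)) 1 (- lambda5)) (mx 3 (- 4) 1 (- 3))"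
  proof (rule mcong_sqrt5_mx)
    show "\<exists>x\<in>golden. lambda5 - 3 = sqrt 5 * x"
      by (rule bexI[of _ "1 - lambda5"]) (simp_all add: sqrt5_eq algebra_simps lambda5_simps)
    show "\<exists>x\<in>golden. - (lambda5 + 1) - - 4 = sqrt 5 * x" "\<exists>x\<in>golden. - lambda5 - - 3 = sqrt 5 * x"
      by (rule bexI[of _ "lambda5 - 1"]; simp add: sqrt5_eq algebra_simps lambda5_simps)+
    show "\<exists>x\<in>golden. 1 - 1 = sqrt 5 * x"
      by (rule bexI[of _ 0]) auto
  qed auto
  ultimately have "lead j 0 (mx 3 (- 4) 1 (- 3))"
    by (rule lead_mcong)
  from lead_add[OF this lead_add[OF lead_int_mult[OF E j, of 4] lead_int_mult[OF F j, of "- 1"] j] j]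
  have "lead j 0 (of_int 3 *\<^sub>R matH)"
    by (simp add: mx_arith)
  from lead_int_mult[OF this j, of 2] have "lead j 0 (of_int 6 *\<^sub>R matH)"
    by (simp add: mx_arith)
  from lead_mcong[OF this mcong_sqrt5_int[of matH 6 1]] have H: "lead j 0 matH"
    by simp
  from lead_add[OF lead_int_mult[OF H j, of a]
      lead_add[OF lead_int_mult[OF E j, of b] lead_int_mult[OF F j, of c] j] j]
  show ?thesis
    by (simp add: mx_arith)
qed

text \<open>
  The trace of \<open>T\<^sup>2 S\<close> is \<open>- 2 \<lambda> \<equiv> - 1\<close> modulo \<open>\<surd>5\<close>, so this element has order 3 there, and its cube
  lies in the congruence subgroup. The six occurrences of \<open>T\<close> make the exponent sum prime to 5.
\<close>

lemma lead_order_3_mod_sqrt5: "lead 1 6 (mx (- 6) 2 (- 2) 1)"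
proof -
  define z where "z = tpow 2 ** matS ** (tpow 2 ** matS) ** (tpow 2 ** matS)"
  have "exp_sum z (2 + 0 + (2 + 0) + (2 + 0))"
    unfolding z_def by (intro exp_sum_mult exp_sum_tpow exp_sum_matS)
  then have "exp_sum z 6"
    by simp
  have "z = mx (- 12 * lambda5 - 8) (4 * lambda5 + 3) (- (4 * lambda5 + 3)) (2 * lambda5)"
    by (simp add: z_def tpow_def matS_eq mx_arith lambda5_simps algebra_simps)
  also have "\<dots> = mat 1 + sqrt 5 ^ 1 *\<^sub>R mx (- 3 * (2 + sqrt 5)) (2 + sqrt 5) (- (2 + sqrt 5)) 1"
    by (simp add: sqrt5_eq mx_arith lambda5_simps algebra_simps)
  finally have z: "z = \<dots>" .
  have "mcong (sqrt 5) (mx (- 3 * (2 + sqrt 5)) (2 + sqrt 5) (- (2 + sqrt 5)) 1) (mx (- 6) 2 (- 2) 1)"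
  proof (rule mcong_sqrt5_mx)
    show "\<exists>x\<in>golden. - 3 * (2 + sqrt 5) - - 6 = sqrt 5 * x"
      by (rule bexI[of _ "- 3"]) (auto simp: algebra_simps)
    show "\<exists>x\<in>golden. 2 + sqrt 5 - 2 = sqrt 5 * x"
      by (rule bexI[of _ 1]) auto
    show "\<exists>x\<in>golden. - (2 + sqrt 5) - - 2 = sqrt 5 * x"
      by (rule bexI[of _ "- 1"]) auto
    show "\<exists>x\<in>golden. 1 - 1 = sqrt 5 * x"
      by (rule bexI[of _ 0]) auto
  qed auto
  then show ?thesis
    unfolding lead_def using \<open>exp_sum z 6\<close> z by fastforce
qed

text \<open>
  The effect on leading coefficients of conjugation by \<open>T\<close>, which is the integral matrix with upper
  right entry 3 modulo \<open>\<surd>5\<close>.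
\<close>

lemma lead_conj_tpow_1:
  fixes a b c d :: int
  assumes "lead j n (mx (of_int a) (of_int b) (of_int c) (of_int d))"
  shows "lead j n (mx (of_int (a + 3 * c)) (of_int (b + 3 * d - 3 * a - 9 * c)) (of_int c) (of_int (d - 3 * c)))"
proof -
  have "mcong (sqrt 5) (tpow e) (mx 1 (of_int (3 * e)) 0 1)" for e
    unfolding tpow_def
  proof (rule mcong_sqrt5_mx)
    show "\<exists>x\<in>golden. of_int e * lambda5 - of_int (3 * e) = sqrt 5 * x"
      by (rule bexI[of _ "of_int e * (1 - lambda5)"])
         (simp_all add: sqrt5_eq algebra_simps lambda5_simps)
  qed (auto intro: bexI[of _ 0])
  from this[of 1] this[of "- 1"]
  have "mcong (sqrt 5) (tpow 1 ** mx a b c d ** tpow (- 1))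
     (mx 1 (of_int (3 * 1)) 0 1 ** mx a b c d ** mx 1 (of_int (3 * (- 1))) 0 1)"
    by (intro mcong_mult mcong_refl) auto
  moreover have "lead j n (tpow 1 ** mx a b c d ** tpow (- 1))"
    by (rule lead_conj[OF assms exp_sum_tpow]) (use exp_sum_tpow[of "- 1"] in \<open>auto simp: tpow_add\<close>)
  ultimately show ?thesis
    using lead_mcong by (fastforce simp: mx_arith algebra_simps)
qed

lemma lead_int_mod_5:
  fixes a b c d a' b' c' d' :: int
  assumes "lead j m (mx (of_int a) (of_int b) (of_int c) (of_int d))"
    and "5 dvd (m - n)" "5 dvd (a - a')" "5 dvd (b - b')" "5 dvd (c - c')" "5 dvd (d - d')"
  shows "lead j n (mx (of_int a') (of_int b') (of_int c') (of_int d'))"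
proof -
  have *: "\<exists>x\<in>golden. of_int k - of_int l = sqrt 5 * x" if kl: "5 dvd (k - l)" for k l
  proof -
    obtain t where "k - l = 5 * t"
      using kl by (elim dvdE)
    then have "of_int k - of_int l = real_of_int (5 * t)"
      by (metis of_int_diff)
    also have "\<dots> = sqrt 5 * (sqrt 5 * of_int t)"
      by simp
    finally show ?thesis
      by (rule bexI) simp
  qed
  have "mcong (sqrt 5) (mx (of_int a) (of_int b) (of_int c) (of_int d))
          (mx (of_int a') (of_int b') (of_int c') (of_int d'))"
    by (rule mcong_sqrt5_mx) (use * assms in auto)
  then show ?thesis
    using assms(1,2) lead_mcong lead_mod_5 by blast
qed

text \<open>
  Conjugate elements have equal exponent sums, so the operator \<open>M \<mapsto> T M T\<inverse> - M\<close> makes exponent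
  sums vanish modulo 5. Applied to the leading coefficient of \<open>(T\<^sup>2 S)\<^sup>3\<close> it gives \<open>- H - E\<close>, and
  applied once more \<open>E\<close>. Subtraction appears as addition of the fourfold, since \<open>- 1 \<equiv> 4\<close>.
\<close>

lemma lead_E_1: "lead 1 0 matE"
proof -
  have "lead 1 6 (mx (of_int (- 6)) (of_int 2) (of_int (- 2)) (of_int 1))"
    using lead_order_3_mod_sqrt5 by simp
  from lead_add[OF lead_conj_tpow_1[OF this] lead_int_mult[OF lead_order_3_mod_sqrt5, of 4]]
  have "lead 1 30 (mx (of_int (- 36)) (of_int 49) (of_int (- 10)) (of_int 11))"
    by (simp add: mx_arith)
  then have B: "lead 1 0 (mx (of_int (- 1)) (of_int (- 1)) (of_int 0) (of_int 1))"
    by (rule lead_int_mod_5) simp_all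
  from lead_add[OF lead_conj_tpow_1[OF B] lead_int_mult[OF B, of 4]]
  have "lead 1 0 (mx (of_int (- 5)) (of_int 1) (of_int 0) (of_int 5))"
    by (simp add: mx_arith)
  then have "lead 1 0 (mx (of_int 0) (of_int 1) (of_int 0) (of_int 0))"
    by (rule lead_int_mod_5) simp_all
  then show ?thesis
    by simp
qed

lemma lead_E: "j \<ge> 1 \<Longrightarrow> lead j 0 matE"
proof (induction j rule: dec_induct)
  case base
  show ?case using lead_E_1 by simp
next
  case (step j)
  have "lead 1 0 matH"
    using lead_E_imp_traceless[OF lead_E_1, of 1 0 0] by simp
  from lead_commutator[OF this step.IH _ step.hyps(1)]
  have "lead (Suc j) 0 (mx 0 2 0 0)"
    by (simp add: mx_arith)
  from lead_int_mult[OF this, of 3]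
  have "lead (Suc j) 0 (mx (of_int 0) (of_int 6) (of_int 0) (of_int 0))"
    by (simp add: mx_arith)
  then have "lead (Suc j) 0 (mx (of_int 0) (of_int 1) (of_int 0) (of_int 0))"
    by (rule lead_int_mod_5) simp_all
  then show ?case
    by simp
qed

text \<open>
  Expanding \<open>det (1 + \<surd>5^j M) = 1\<close> shows that the trace of \<open>M\<close> is divisible by \<open>\<surd>5^j\<close>.
\<close>

lemma lead_trace:
  assumes "lead j n M" "j \<ge> 1"
  shows "\<exists>a b c :: int. mcong (sqrt 5) M (mx (of_int a) (of_int b) (of_int c) (- of_int a))"
proof -
  obtain g m M' where g: "exp_sum g m" "g = mat 1 + sqrt 5 ^ j *\<^sub>R M'" "mcong (sqrt 5) M' M"
    using assms(1) unfolding lead_def by blast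
  obtain x y u v where M': "M' = mx x y u v" "x \<in> golden" "y \<in> golden" "u \<in> golden" "v \<in> golden"
    using g(3) by (auto simp: mcong_def elim!: gmatE)
  have "1 = det g"
    using exp_sum_det[OF g(1)] by simp
  also have "\<dots> = 1 + sqrt 5 ^ j * (x + v + sqrt 5 ^ j * (x * v - y * u))"
    by (simp add: g M' mx_arith det_2 algebra_simps)
  finally have "x + v = - (sqrt 5 ^ j * (x * v - y * u))"
    by simp
  also have "\<dots> = sqrt 5 * (- (sqrt 5 ^ (j - 1) * (x * v - y * u)))"
    using assms(2) by (cases j) auto
  finally have tr: "x + v = sqrt 5 * (- (sqrt 5 ^ (j - 1) * (x * v - y * u)))" .
  define t where "t = - (sqrt 5 ^ (j - 1) * (x * v - y * u))"
  have t: "t \<in> golden" "v = sqrt 5 * t - x"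
    using tr M' by (auto simp: t_def)
  obtain a x' where a: "x' \<in> golden" "x = of_int a + sqrt 5 * x'"
    using golden_residue[OF M'(2)] by blast
  obtain b y' where b: "y' \<in> golden" "y = of_int b + sqrt 5 * y'"
    using golden_residue[OF M'(3)] by blast
  obtain c u' where c: "u' \<in> golden" "u = of_int c + sqrt 5 * u'"
    using golden_residue[OF M'(4)] by blast
  have "mcong (sqrt 5) M' (mx (of_int a) (of_int b) (of_int c) (- of_int a))"
    unfolding M'(1)
  proof (rule mcong_sqrt5_mx)
    show "\<exists>r\<in>golden. v - - of_int a = sqrt 5 * r"
      using a t by (intro bexI[of _ "t - x'"]) (auto simp: algebra_simps)
  qed (use a b c M' in auto)
  then show ?thesis
    using mcong_trans[OF mcong_sym[OF g(3)]] by blast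
qed

text \<open>
  An element of exponent sum 6 can be multiplied by an element of the kernel of \<open>\<phi>\<close> with the
  opposite leading coefficient, which brings it one level deeper.
\<close>

lemma lead_6_clear:
  assumes "lead j 6 M" "j \<ge> 1"
  shows "lead j 6 0"
proof -
  obtain a b c where *: "mcong (sqrt 5) M (mx (of_int a) (of_int b) (of_int c) (- of_int a))"
    using lead_trace[OF assms] by blast
  from lead_add[OF lead_mcong[OF assms(1) *]
      lead_E_imp_traceless[OF lead_E[OF assms(2)] assms(2), of "- a" "- b" "- c"] assms(2)]
  show ?thesis
    by (simp add: mx_arith)
qed

lemma lead_6_zero: "j \<ge> 1 \<Longrightarrow> lead j 6 0"
proof (induction j rule: dec_induct)
  case base
  show ?case
    by (rule lead_6_clear[OF lead_order_3_mod_sqrt5]) simp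
next
  case (step j)
  obtain g m M' where g: "exp_sum g m" "5 dvd (m - 6)" "g = mat 1 + sqrt 5 ^ j *\<^sub>R M'"
    "mcong (sqrt 5) M' 0"
    using step.IH unfolding lead_def by blast
  obtain a b c d where M': "M' = mx (sqrt 5 * a) (sqrt 5 * b) (sqrt 5 * c) (sqrt 5 * d)"
    and abcd: "a \<in> golden" "b \<in> golden" "c \<in> golden" "d \<in> golden"
    using g(4) by (auto simp: mcong_def elim!: gmatE)
  have gj: "g = mat 1 + sqrt 5 ^ Suc j *\<^sub>R mx a b c d"
    by (simp add: g M' mx_arith)
  have "lead (Suc j) 6 (mx a b c d)"
    unfolding lead_def
    by (intro exI[of _ g] exI[of _ m] exI[of _ "mx a b c d"] conjI g(1,2) gj mcong_refl
        mx_in_gmat_1 abcd)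
  then show ?case
    by (rule lead_6_clear) simp
qed

lemma exp_sum_nonzero_at_5:
  assumes "k \<ge> 1"
  shows "\<exists>g n. exp_sum g n \<and> \<not> 5 dvd n \<and> mcong (of_int (5 ^ k)) g (mat 1)"
proof -
  have "2 * k \<ge> 1" using assms by simp
  then obtain g m M' where g: "exp_sum g m" "5 dvd (m - 6)" "g = mat 1 + sqrt 5 ^ (2 * k) *\<^sub>R M'"
      "mcong (sqrt 5) M' 0"
    using lead_6_zero unfolding lead_def by blast
  obtain a b c d where M': "M' = mx a b c d"
      and abcd: "a \<in> golden" "b \<in> golden" "c \<in> golden" "d \<in> golden"
    using g(4) by (auto simp: mcong_def elim!: gmatE)
  have "g - mat 1 \<in> gmat (of_int (5 ^ k))"
    by (rule gmatI[of _ _ a b c d]) (use abcd in \<open>auto simp: g M' power_mult\<close>)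
  moreover have "\<not> 5 dvd m"
    using g(2) by presburger
  ultimately show ?thesis
    using g(1) exp_sum_gmat[OF g(1)] by (auto simp: mcong_def)
qed

section \<open>Removing the part of the level prime to 5\<close>

text \<open>
  Solving \<open>(T S)\<^sup>5 = 1\<close> for \<open>S\<close> gives \<open>S = T\<inverse> S T\<inverse> S T\<inverse> S T\<inverse> S T\<inverse>\<close>, as \<open>S\<inverse> = - S\<close> occurs four
  times. Replacing \<open>T\<close> by \<open>T^e\<close> on the right-hand side interpolates between \<open>S\<close> at \<open>e = 1\<close> and
  \<open>S\<^sup>4 = 1\<close> at \<open>e = 0\<close>.
\<close>

definition lift_S :: "int \<Rightarrow> real^2^2" where
  "lift_S e = tpow (- e) ** matS ** tpow (- e) ** matS ** tpow (- e) ** matS ** tpow (- e) ** matS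
                ** tpow (- e)"

lemma lift_S_1: "lift_S 1 = matS" and lift_S_0: "lift_S 0 = mat 1"
  by (simp_all add: lift_S_def tpow_def matS_eq mx_arith lambda5_simps algebra_simps)

lemma mcong_tpow:
  assumes "m dvd (a - b)"
  shows "mcong (of_int m) (tpow a) (tpow b)"
proof -
  obtain t where "a - b = m * t"
    using assms by (elim dvdE)
  then have a: "a = b + m * t" by simp
  have "tpow a - tpow b \<in> gmat (of_int m)"
    by (rule gmatI[of _ _ 0 "of_int t * lambda5" 0 0]) (auto simp: a tpow_def mx_arith algebra_simps)
  then show ?thesis
    by (simp add: mcong_def)
qed

lemma mcong_lift_S:
  assumes "m dvd (a - b)"
  shows "mcong (of_int m) (lift_S a) (lift_S b)"
proof -
  have "m dvd (- a - (- b))"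
    using assms by (metis dvd_minus_iff minus_diff_eq minus_diff_minus)
  then show ?thesis
    unfolding lift_S_def by (intro mcong_mult mcong_tpow mcong_refl) auto
qed

lemma exp_sum_lift_S: "exp_sum (lift_S e) (- 5 * e)"
  unfolding lift_S_def
  by (rule exp_sum_cong, (rule exp_sum_mult exp_sum_tpow exp_sum_matS)+) simp

text \<open>
  In a word for \<open>g\<close>, each \<open>T\<close> is replaced by \<open>T^e\<close> and each \<open>S\<close> by \<open>lift_S e\<close>, where \<open>e \<equiv> 1\<close>
  modulo \<open>m\<close> and \<open>e \<equiv> 0\<close> modulo \<open>q\<close>.
\<close>

lemma exp_sum_crt:
  assumes "exp_sum g n" and mq: "coprime m q" and "5 dvd q"
  shows "\<exists>h k. exp_sum h k \<and> 5 dvd k \<and> mcong (of_int m) h g \<and> mcong (of_int q) h (mat 1)"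
proof -
  obtain u v where uv: "u * m + v * q = 1"
    using mq by (metis bezout_int coprime_iff_gcd_eq_1)
  define e where "e = v * q"
  have "e - 1 = m * (- u)"
    using uv by (simp add: e_def algebra_simps)
  then have e: "m dvd (e - 1)" "q dvd (e - 0)" "5 dvd e"
    using \<open>5 dvd q\<close> by (auto simp: e_def)
  show ?thesis
    using assms(1)
  proof induction
    case one
    show ?case
      using exp_sum.one mcong_refl[OF gmat_one] by blast
  next
    case (S g n)
    then obtain h k where h: "exp_sum h k" "5 dvd k" "mcong (of_int m) h g" "mcong (of_int q) h (mat 1)"
      by blast
    have "mcong (of_int m) (lift_S e ** h) (matS ** g)"
      using mcong_mult[OF mcong_lift_S[OF e(1)] h(3)] by (simp add: lift_S_1)
    moreover have "mcong (of_int q) (lift_S e ** h) (mat 1)"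
      using mcong_mult[OF mcong_lift_S[OF e(2)] h(4)] by (simp add: lift_S_0)
    moreover have "exp_sum (lift_S e ** h) (- 5 * e + k)"
      by (intro exp_sum_mult exp_sum_lift_S h)
    moreover have "5 dvd (- 5 * e + k)"
      using h by simp
    ultimately show ?case
      by blast
  next
    case (T g n a)
    then obtain h k where h: "exp_sum h k" "5 dvd k" "mcong (of_int m) h g" "mcong (of_int q) h (mat 1)"
      by blast
    have "m dvd (a * (e - 1))" "q dvd (a * (e - 0))"
      using e by (simp_all only: dvd_mult)
    then have d: "m dvd (a * e - a)" "q dvd (a * e - 0)"
      by (simp_all add: algebra_simps)
    have "mcong (of_int m) (tpow (a * e) ** h) (tpow a ** g)"
      using mcong_mult[OF mcong_tpow[OF d(1)] h(3)] .
    moreover have "mcong (of_int q) (tpow (a * e) ** h) (mat 1)"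
      using mcong_mult[OF mcong_tpow[OF d(2)] h(4)] by simp
    moreover have "exp_sum (tpow (a * e) ** h) (a * e + k)"
      by (intro exp_sum_mult exp_sum_tpow h)
    moreover have "5 dvd (a * e + k)"
      using h e by simp
    ultimately show ?case
      by blast
  qed
qed

text \<open>
  Let \<open>z\<close> be trivial modulo \<open>q\<close> with \<open>\<phi>(z) \<noteq> 0\<close>, and let \<open>h\<close> in the kernel of \<open>\<phi>\<close> agree with
  \<open>z\<close> modulo \<open>m\<close> and be trivial modulo \<open>q\<close>. Then \<open>z h\<inverse>\<close> is trivial modulo both.
\<close>

theorem exp_sum_nonzero_at_every_level:
  fixes N :: int
  assumes "N > 0"
  shows "\<exists>g n. exp_sum g n \<and> \<not> 5 dvd n \<and> mcong (of_int N) g (mat 1)"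
proof -
  define r where "r = multiplicity 5 N"
  obtain m where m: "N = 5 ^ r * m" "\<not> 5 dvd m"
    using multiplicity_decompose'[of N 5] assms unfolding r_def by (metis less_irrefl zdvd1_eq abs_numeral numeral_eq_one_iff semiring_norm(84))
  \<comment> \<open>the exponent is at least 1, so that \<open>5 dvd q\<close> even when \<open>N\<close> is prime to 5\<close>
  define q :: int where "q = 5 ^ Suc r"
  have "coprime 5 m"
    using m(2) by (intro prime_imp_coprime) auto
  then have mq: "coprime m q"
    by (simp add: q_def coprime_commute)
  obtain z n where z: "exp_sum z n" "\<not> 5 dvd n" "mcong (of_int q) z (mat 1)"
    using exp_sum_nonzero_at_5[of "Suc r"] unfolding q_def by auto
  obtain h k where h: "exp_sum h k" "5 dvd k" "mcong (of_int m) h z" "mcong (of_int q) h (mat 1)"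
    using exp_sum_crt[OF z(1) mq] by (auto simp: q_def)
  obtain h' where h': "exp_sum h' (- k)" "h ** h' = mat 1"
    using exp_sum_inverse[OF h(1)] by blast
  have h'g: "mcong s h' h'" for s
    by (rule mcong_refl[OF exp_sum_gmat[OF h'(1)]])
  have "mcong (of_int m) (z ** h') (mat 1)"
    using mcong_mult[OF mcong_sym[OF h(3)] h'g] by (simp add: h')
  moreover have "mcong (of_int q) (z ** h') (mat 1)"
    using mcong_mult[OF mcong_trans[OF z(3) mcong_sym[OF h(4)]] h'g] by (simp add: h')
  ultimately have "mcong (of_int (m * q)) (z ** h') (mat 1)"
    by (rule mcong_coprime[OF mq])
  then have "z ** h' - mat 1 \<in> gmat (of_int N * 5)" "z ** h' \<in> gmat 1"
    by (simp_all add: mcong_def m(1) q_def mult_ac)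
  then have "mcong (of_int N) (z ** h') (mat 1)"
    using gmat_mono[of _ "of_int N" 5] by (simp add: mcong_def)
  moreover have "\<not> 5 dvd (n + - k)"
    using z(2) h(2) by presburger
  ultimately show ?thesis
    using exp_sum_mult[OF z(1) h'(1)] by blast
qed

section \<open>Fifth powers and commutators\<close>

text \<open>
  The kernel of \<open>\<phi>\<close> as a subgroup of the inhomogeneous group; \<open>\<phi>\<close> passes to the quotient because
  \<open>- 1 = S\<^sup>2\<close> has exponent sum 0.
\<close>

definition exp_sum_kernel :: "(real^2^2) set set" where
  "exp_sum_kernel = {Z5 #>\<^bsub>H5\<^esub> g | g n. exp_sum g n \<and> 5 dvd n}"

lemma exp_sum_kernelI: "exp_sum g n \<Longrightarrow> 5 dvd n \<Longrightarrow> Z5 #>\<^bsub>H5\<^esub> g \<in> exp_sum_kernel"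
  by (auto simp: exp_sum_kernel_def)

lemma G5_carrierE:
  assumes "x \<in> carrier G5"
  obtains g n where "exp_sum g n" "x = Z5 #>\<^bsub>H5\<^esub> g"
proof -
  obtain g where g: "g \<in> carrier H5" "x = Z5 #>\<^bsub>H5\<^esub> g"
    using assms by (auto simp: G5_def carrier_FactGroup)
  obtain n where "exp_sum g n"
    using H5_imp_exp_sum[OF g(1)] by blast
  with g(2) show thesis by (rule that[rotated])
qed

lemma coset_in_G5: "exp_sum g n \<Longrightarrow> Z5 #>\<^bsub>H5\<^esub> g \<in> carrier G5"
  using exp_sum_imp_H5 by (auto simp: G5_def carrier_FactGroup)

lemma coset_mult_G5:
  assumes "exp_sum g m" "exp_sum h n"
  shows "(Z5 #>\<^bsub>H5\<^esub> g) \<otimes>\<^bsub>G5\<^esub> (Z5 #>\<^bsub>H5\<^esub> h) = Z5 #>\<^bsub>H5\<^esub> (g ** h)"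
  using normal.rcos_sum[OF Z5_normal exp_sum_imp_H5[OF assms(1)] exp_sum_imp_H5[OF assms(2)]]
  by (simp add: G5_def H5_mult)

lemma coset_one_G5: "Z5 #>\<^bsub>H5\<^esub> (mat 1) = \<one>\<^bsub>G5\<^esub>"
  using group.coset_mult_one[OF group_H5, of Z5]
    normal_imp_subgroup[OF Z5_normal, THEN subgroup.subset] by (simp add: G5_def H5_one)

lemma coset_inv_G5:
  assumes "exp_sum g n"
  obtains h where "exp_sum h (- n)" "inv\<^bsub>G5\<^esub> (Z5 #>\<^bsub>H5\<^esub> g) = Z5 #>\<^bsub>H5\<^esub> h"
proof -
  obtain h where h: "exp_sum h (- n)" "h ** g = mat 1"
    using exp_sum_inverse[OF assms] by blast
  then have "inv\<^bsub>G5\<^esub> (Z5 #>\<^bsub>H5\<^esub> g) = Z5 #>\<^bsub>H5\<^esub> h"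
    using assms by (intro group.inv_equality[OF group_G5])
      (auto simp: coset_mult_G5 coset_one_G5 intro: coset_in_G5)
  with h show thesis by (intro that)
qed

lemma exp_sum_kernel_subgroup: "subgroup exp_sum_kernel G5"
proof (rule group.subgroupI[OF group_G5])
  show "exp_sum_kernel \<subseteq> carrier G5"
    by (auto simp: exp_sum_kernel_def intro: coset_in_G5)
  show "exp_sum_kernel \<noteq> {}"
    using exp_sum_kernelI[OF exp_sum.one] by auto
next
  fix x assume "x \<in> exp_sum_kernel"
  then obtain g n where g: "x = Z5 #>\<^bsub>H5\<^esub> g" "exp_sum g n" "5 dvd n"
    by (auto simp: exp_sum_kernel_def)
  obtain h where "exp_sum h (- n)" "inv\<^bsub>G5\<^esub> x = Z5 #>\<^bsub>H5\<^esub> h"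
    using coset_inv_G5[OF g(2)] g(1) by blast
  then show "inv\<^bsub>G5\<^esub> x \<in> exp_sum_kernel"
    using exp_sum_kernelI[of h "- n"] g(3) by simp
next
  fix x y assume "x \<in> exp_sum_kernel" "y \<in> exp_sum_kernel"
  then obtain g m h n where "x = Z5 #>\<^bsub>H5\<^esub> g" "exp_sum g m" "5 dvd m"
    "y = Z5 #>\<^bsub>H5\<^esub> h" "exp_sum h n" "5 dvd n"
    by (auto simp: exp_sum_kernel_def)
  then show "x \<otimes>\<^bsub>G5\<^esub> y \<in> exp_sum_kernel"
    using exp_sum_kernelI[OF exp_sum_mult, of g m h n] by (simp add: coset_mult_G5)
qed

lemma G5_fifth_powers_subset: "G5_fifth_powers \<subseteq> exp_sum_kernel"
  unfolding G5_fifth_powers_def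
proof (rule group.generate_subgroup_incl[OF group_G5 _ exp_sum_kernel_subgroup], clarify)
  interpret G: group G5 by (rule group_G5)
  fix x assume "x \<in> carrier G5"
  then obtain g n where g: "exp_sum g n" "x = Z5 #>\<^bsub>H5\<^esub> g"
    by (rule G5_carrierE)
  have "\<exists>h. exp_sum h (int k * n) \<and> x [^]\<^bsub>G5\<^esub> k = Z5 #>\<^bsub>H5\<^esub> h" for k :: nat
  proof (induction k)
    case 0
    show ?case
      using exp_sum.one coset_one_G5 by (intro exI[of _ "mat 1"]) simp
  next
    case (Suc k)
    then obtain h where h: "exp_sum h (int k * n)" "x [^]\<^bsub>G5\<^esub> k = Z5 #>\<^bsub>H5\<^esub> h"
      by blast
    then show ?case
      using exp_sum_mult[OF h(1) g(1)] g
      by (intro exI[of _ "h ** g"]) (auto simp: coset_mult_G5 algebra_simps)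
  qed
  from this[of 5] show "x [^]\<^bsub>G5\<^esub> (5 :: nat) \<in> exp_sum_kernel"
    using exp_sum_kernelI by fastforce
qed

lemma G5_commutator_subset: "G5_commutator \<subseteq> exp_sum_kernel"
  unfolding G5_commutator_def derived_def
proof (rule group.generate_subgroup_incl[OF group_G5 _ exp_sum_kernel_subgroup], clarify)
  fix x y assume "x \<in> carrier G5" "y \<in> carrier G5"
  then obtain g m h n where g: "exp_sum g m" "x = Z5 #>\<^bsub>H5\<^esub> g"
    and h: "exp_sum h n" "y = Z5 #>\<^bsub>H5\<^esub> h"
    by (metis G5_carrierE)
  obtain g' where g': "exp_sum g' (- m)" "inv\<^bsub>G5\<^esub> x = Z5 #>\<^bsub>H5\<^esub> g'"
    using coset_inv_G5[OF g(1)] g(2) by blast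
  obtain h' where h': "exp_sum h' (- n)" "inv\<^bsub>G5\<^esub> y = Z5 #>\<^bsub>H5\<^esub> h'"
    using coset_inv_G5[OF h(1)] h(2) by blast
  note e1 = exp_sum_mult[OF g(1) h(1)]
  note e2 = exp_sum_mult[OF e1 g'(1)]
  note e3 = exp_sum_mult[OF e2 h'(1)]
  have "x \<otimes>\<^bsub>G5\<^esub> y \<otimes>\<^bsub>G5\<^esub> inv\<^bsub>G5\<^esub> x \<otimes>\<^bsub>G5\<^esub> inv\<^bsub>G5\<^esub> y = Z5 #>\<^bsub>H5\<^esub> (g ** h ** g' ** h')"
    unfolding g'(2) h'(2) unfolding g(2) h(2)
    by (simp only: coset_mult_G5[OF g(1) h(1)] coset_mult_G5[OF e1 g'(1)] coset_mult_G5[OF e2 h'(1)])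
  then show "x \<otimes>\<^bsub>G5\<^esub> y \<otimes>\<^bsub>G5\<^esub> inv\<^bsub>G5\<^esub> x \<otimes>\<^bsub>G5\<^esub> inv\<^bsub>G5\<^esub> y \<in> exp_sum_kernel"
    using exp_sum_kernelI[OF e3] by simp
qed

lemma Z5_coset: "Z5 #>\<^bsub>H5\<^esub> g = {g, - g}"
  by (auto simp: r_coset_def Z5_def H5_mult neg_mat1_mult)

lemma G5_level_not_subset_exp_sum_kernel:
  assumes A: "ideal A Z_lambda5" "A \<noteq> {0}"
  shows "\<not> G5_level A \<subseteq> exp_sum_kernel"
proof
  assume sub: "G5_level A \<subseteq> exp_sum_kernel"
  obtain N :: int where N: "N > 0" "of_int N \<in> A"
    using nonzero_ideal_contains_pos_int[OF A] .
  obtain g n where g: "exp_sum g n" "\<not> 5 dvd n" "mcong (of_int N) g (mat 1)"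
    using exp_sum_nonzero_at_every_level[OF N(1)] by blast
  obtain a b c d where D: "g - mat 1 = mx (of_int N * a) (of_int N * b) (of_int N * c) (of_int N * d)"
    and abcd: "a \<in> golden" "b \<in> golden" "c \<in> golden" "d \<in> golden"
    using g(3) by (auto simp: mcong_def elim!: gmatE)
  have "g = mx (of_int N * a) (of_int N * b) (of_int N * c) (of_int N * d) + mat 1"
    using D by (simp add: diff_eq_eq)
  then have entries: "g $ 1 $ 1 - 1 = of_int N * a" "g $ 1 $ 2 = of_int N * b"
    "g $ 2 $ 1 = of_int N * c" "g $ 2 $ 2 - 1 = of_int N * d"
    by (simp_all add: mx_arith)
  have "g \<in> H5_level A"
    using exp_sum_imp_H5[OF g(1)] abcd ideal_Z_lambda5_absorb[OF A(1) N(2)]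
    by (auto simp: H5_level_def entries)
  then have "Z5 #>\<^bsub>H5\<^esub> g \<in> exp_sum_kernel"
    using sub by (auto simp: G5_level_eq)
  then obtain h m where h: "Z5 #>\<^bsub>H5\<^esub> g = Z5 #>\<^bsub>H5\<^esub> h" "exp_sum h m" "5 dvd m"
    by (auto simp: exp_sum_kernel_def)
  then have "g = h \<or> g = - h"
    unfolding Z5_coset by blast
  then have "exp_sum g m"
    using h(2) exp_sum_neg by auto
  then have "5 dvd (n - m)"
    using exp_sum_unique g(1) by blast
  with h(3) g(2) show False
    by presburger
qed

theorem proposition5p2:
  shows "\<not> congruence_subgroup G5_fifth_powers
       \<and> \<not> congruence_subgroup G5_commutator
       \<and> \<not> (\<exists>A. ideal A Z_lambda5 \<and> A \<noteq> {0} \<and> G5_level A \<subseteq> G5_fifth_powers)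
       \<and> \<not> (\<exists>A. ideal A Z_lambda5 \<and> A \<noteq> {0} \<and> G5_level A \<subseteq> G5_commutator)"
  using G5_level_not_subset_exp_sum_kernel G5_fifth_powers_subset G5_commutator_subset
  unfolding congruence_subgroup_def by blast

end
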